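(* Let $n\ge1$, $0<s<1$, and $1\le p,q,r\le\infty$ with $\frac1p+\frac1q=\frac1r$. Then there is a constant $C>0$ such that for all $k\in\mathbf{Z}$ and all $f,g\in\mathcal{S}(\mathbf{R}^n)$, $$\|[P_k,f]g\|_{L^r}\le C\,2^{-sk}\,\bigl\||D|^s f\bigr\|_{L^p}\,\|g\|_{L^q},$$ where $[P_k,f]g=P_k(fg)-fP_k(g)$ and $P_k$ is the $k$-th Littlewood-Paley projection.
   Context: $\mathcal{S}(\mathbf{R}^n)$ is the Schwartz space. The Fourier transform is $\hat f(\xi)=\int_{\mathbf{R}^n} f(x)e^{-2\pi i x\cdot\xi}\,dx$, and $|D|^s$ is the Fourier multiplier operator with symbol $|\xi|^s$. Littlewood-Paley projections: fix a nonnegative, decreasing (non-increasing) function $\psi:[0,\infty)\to[0,\infty)$, smooth away from zero, supported in $[0,2]$ and equal to $1$ on $[0,1]$. Set $\varphi(\xi)=\psi(\xi)-\psi(2\xi)$ and, on $\mathbf{R}^n$, $\varphi(\xi)=\varphi(|\xi|)$; thus $\varphi$ is smooth, $\operatorname{supp}\varphi\subseteq\{1/2\le|\xi|\le2\}$ and $\sum_{k\in\mathbf{Z}}\varphi(2^{-k}\xi)=1$ for $\xi\neq0$. The operator $P_k$ is defined by $\widehat{P_kf}(\xi)=\varphi(2^{-k}\xi)\hat f(\xi)$. *)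

theory Defs
  imports "HOL-Analysis.Analysis" "HOL-Probability.Essential_Supremum"
begin

text \<open>The iterated derivative along the vectors in \<open>bs\<close>; when these are basis vectors and \<open>f\<close>
  is smooth, these are exactly the iterated partial derivatives of \<open>f\<close>.\<close>

definition iter_deriv :: "'a::euclidean_space list \<Rightarrow> ('a \<Rightarrow> complex) \<Rightarrow> 'a \<Rightarrow> complex" where
  "iter_deriv bs f = foldr (\<lambda>b h x. frechet_derivative h (at x) b) bs f"

definition schwartz :: "('a::euclidean_space \<Rightarrow> complex) \<Rightarrow> bool" where
  "schwartz f \<longleftrightarrow>
     (\<forall>bs. set bs \<subseteq> Basis \<longrightarrow>
        (\<forall>x. iter_deriv bs f differentiable (at x)) \<and>
        (\<forall>N::nat. bounded (range (\<lambda>x. norm x ^ N *\<^sub>R iter_deriv bs f x))))"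

definition fourier :: "('a::euclidean_space \<Rightarrow> complex) \<Rightarrow> 'a \<Rightarrow> complex" where
  "fourier f \<xi> =
     (LINT x|lborel. f x * exp (- 2 * complex_of_real pi * \<i> * complex_of_real (x \<bullet> \<xi>)))"

definition inverse_fourier :: "('a::euclidean_space \<Rightarrow> complex) \<Rightarrow> 'a \<Rightarrow> complex" where
  "inverse_fourier h x =
     (LINT \<xi>|lborel. h \<xi> * exp (2 * complex_of_real pi * \<i> * complex_of_real (x \<bullet> \<xi>)))"

text \<open>The inversion integral below converges absolutely for Schwartz \<open>f\<close> and a measurable symbol
  \<open>m\<close> of polynomial growth, and this is the only case in which multipliers are used.\<close>

definition fourier_multiplier ::
    "('a::euclidean_space \<Rightarrow> complex) \<Rightarrow> ('a \<Rightarrow> complex) \<Rightarrow> 'a \<Rightarrow> complex" where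
  "fourier_multiplier m f = inverse_fourier (\<lambda>\<xi>. m \<xi> * fourier f \<xi>)"

definition abs_D_powr :: "real \<Rightarrow> ('a::euclidean_space \<Rightarrow> complex) \<Rightarrow> 'a \<Rightarrow> complex" where
  "abs_D_powr s = fourier_multiplier (\<lambda>\<xi>. complex_of_real (norm \<xi> powr s))"

text \<open>Only the values of \<open>\<psi>\<close> on \<open>[0,\<infinity>)\<close> matter.\<close>

definition lp_cutoff :: "(real \<Rightarrow> real) \<Rightarrow> bool" where
  "lp_cutoff \<psi> \<longleftrightarrow>
     (\<forall>t\<ge>0. 0 \<le> \<psi> t) \<and>
     antimono_on {0..} \<psi> \<and>
     (\<forall>m. \<forall>t>0. (deriv ^^ m) \<psi> differentiable (at t)) \<and>
     (\<forall>t>2. \<psi> t = 0) \<and>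
     (\<forall>t\<in>{0..1}. \<psi> t = 1)"

definition lp_symbol :: "(real \<Rightarrow> real) \<Rightarrow> 'a::euclidean_space \<Rightarrow> real" where
  "lp_symbol \<psi> \<xi> = \<psi> (norm \<xi>) - \<psi> (2 * norm \<xi>)"

definition lp_proj ::
    "(real \<Rightarrow> real) \<Rightarrow> int \<Rightarrow> ('a::euclidean_space \<Rightarrow> complex) \<Rightarrow> 'a \<Rightarrow> complex" where
  "lp_proj \<psi> k =
     fourier_multiplier (\<lambda>\<xi>. complex_of_real (lp_symbol \<psi> ((2 powi (- k)) *\<^sub>R \<xi>)))"

definition lp_commutator ::
    "(real \<Rightarrow> real) \<Rightarrow> int \<Rightarrow> ('a::euclidean_space \<Rightarrow> complex) \<Rightarrow> ('a \<Rightarrow> complex) \<Rightarrow> 'a \<Rightarrow> complex" where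
  "lp_commutator \<psi> k f g = (\<lambda>x. lp_proj \<psi> k (\<lambda>y. f y * g y) x - f x * lp_proj \<psi> k g x)"

text \<open>The \<open>L\<^sup>p\<close> norm with values in \<open>[0,\<infinity>]\<close>, for \<open>1 \<le> p \<le> \<infinity>\<close>. There is no \<open>powr\<close> on
  \<^typ>\<open>ennreal\<close>, so an infinite integral is treated separately.\<close>

definition Lp_norm :: "ennreal \<Rightarrow> ('a::euclidean_space \<Rightarrow> complex) \<Rightarrow> ennreal" where
  "Lp_norm p f =
     (if p = \<infinity> then esssup lborel (\<lambda>x. ennreal (norm (f x)))
      else let I = (\<integral>\<^sup>+ x. ennreal (norm (f x) powr enn2real p) \<partial>lborel)
           in if I = \<infinity> then \<infinity> else ennreal (enn2real I powr (1 / enn2real p)))"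

end

theory Submission
  imports Defs "HOL-Probability.Characteristic_Functions" "HOL-Probability.Sinc_Integral"
begin

text \<open>
  The commutator is \<open>\<integral> K(h) (f(x - h) - f(x)) g(x - h) dh\<close> with \<open>K\<close> the kernel of \<open>P\<^sub>k\<close>. Writing \<open>|\<xi>|\<^sup>-\<^sup>s\<close> as
  the average \<open>(1/c) \<integral> exp (- \<pi> t\<^sup>2 |\<xi>|\<^sup>2) t\<^sup>s\<^sup>-\<^sup>1 dt\<close> over \<open>t > 0\<close> and using Fourier inversion,
  \<open>f(x - h) - f(x)\<close> becomes \<open>(1/c) \<integral>\<integral> (H\<^sub>t(z - h) - H\<^sub>t(z)) (|D|\<^sup>s f)(x - z) dz t\<^sup>s\<^sup>-\<^sup>1 dt\<close>, where \<open>H\<^sub>t\<close> is the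
  Gaussian of width \<open>t\<close> and mass \<open>1\<close>. Hence the commutator is dominated by an average of the products
  \<open>|(|D|\<^sup>s f)(x - z)| |g(x - h)|\<close> against a positive weight in \<open>(h, z)\<close>, and the inequalities of Minkowski and
  Hoelder bound its norm by the mass of the weight. Since \<open>H\<^sub>t(\<cdot> - h) - H\<^sub>t\<close> has \<open>L\<^sup>1\<close> norm at most
  \<open>3 min (1, |h| / t)\<close> and \<open>0 < s < 1\<close>, the mass is at most a constant times
  \<open>\<integral> |K(h)| |h|\<^sup>s dh\<close>, which scales like \<open>2\<^sup>-\<^sup>s\<^sup>k\<close>.
\<close>

subsection \<open>Lebesgue measure on Euclidean spaces\<close>

text \<open>The increment f(x - h) - f(x) is essential: each \<open>H_t\<close> has mass 1 and
  t^(s-1) is not integrable at infinity, so the same average taken for f(x) alone has infinite mass.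
  Equivalently, the average of the \<open>H_t\<close> is a multiple of the Riesz kernel |z|^(s-n),
  which is not integrable, while its increments are, with mass of order |h|^s. The increment gains a
  factor |h| / t for large t, and this suffices because s < 1; small t is harmless because s > 0.
  Keeping t fixed until the end makes every exchange of integrals absolutely convergent and the L^1
  bound explicit. In general \<open>|D|^s f\<close> is no Schwartz function. It enters only as the
  inverse transform of an integrable function, and all estimates take place in [0, \<infinity>], so
  an infinite norm is allowed. That |K(h)| |h|^s is integrable rests on the symbol being a Schwartz
  function. Only the origin is in doubt, and there the symbol vanishes because \<psi> equals 1 near
  0. The resulting constant depends on n, s and \<psi>, but not on p, q, r.\<close>

lemma nn_integral_lborel_affine:
  fixes t :: "'a::euclidean_space"
  assumes [measurable]: "f \<in> borel_measurable borel" and c: "c \<noteq> 0"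
  shows "(\<integral>\<^sup>+x. f x \<partial>lborel) = ennreal (\<bar>c\<bar> ^ DIM('a)) * (\<integral>\<^sup>+x. f (t + c *\<^sub>R x) \<partial>lborel)"
  by (subst lborel_affine[OF c, of t])
     (simp add: nn_integral_density nn_integral_distr nn_integral_cmult ennreal_power)

lemma nn_integral_lborel_translation:
  fixes h :: "'a::euclidean_space"
  assumes [measurable]: "f \<in> borel_measurable borel"
  shows "(\<integral>\<^sup>+z. f (z - h) \<partial>lborel) = (\<integral>\<^sup>+z. f z \<partial>lborel)"
  using nn_integral_lborel_affine[of f 1 "- h"] by simp

lemma integrable_lborel_affine:
  fixes t :: "'a::euclidean_space" and f :: "'a \<Rightarrow> 'b::{banach, second_countable_topology}"
  assumes f: "integrable lborel f" and c: "c \<noteq> 0"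
  shows "integrable lborel (\<lambda>x. f (t + c *\<^sub>R x))"
  using f f[THEN borel_measurable_integrable] c unfolding integrable_iff_bounded
  by (subst (asm) nn_integral_lborel_affine[where c=c and t=t]) (auto simp: ennreal_mult_less_top)

lemma integral_lborel_affine:
  fixes t :: "'a::euclidean_space" and f :: "'a \<Rightarrow> 'b::{banach, second_countable_topology}"
  assumes c: "c \<noteq> 0"
  shows "(\<integral>x. f x \<partial>lborel) = (\<bar>c\<bar> ^ DIM('a)) *\<^sub>R (\<integral>x. f (t + c *\<^sub>R x) \<partial>lborel)"
proof cases
  assume f[measurable]: "integrable lborel f" then show ?thesis
    using c f f[THEN borel_measurable_integrable] f[THEN integrable_lborel_affine, of c t]
    by (subst lborel_affine[OF c, of t])
       (simp add: integral_density integral_distr)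
next
  assume not: "\<not> integrable lborel f"
  have "\<not> integrable lborel (\<lambda>x. f (t + c *\<^sub>R x))"
  proof
    assume "integrable lborel (\<lambda>x. f (t + c *\<^sub>R x))"
    from integrable_lborel_affine[OF this, of "1/c" "- t /\<^sub>R c"] c not show False
      by (simp add: algebra_simps)
  qed
  with not show ?thesis by (simp add: not_integrable_integral_eq)
qed

text \<open>\<open>lborel\<close> is the image of a finite product of Lebesgue measures on the line.
  This reduces Gaussian integrals and the integrability of inverse powers to dimension one.\<close>

lemma lborel_product_integral:
  fixes f :: "'a::euclidean_space \<Rightarrow> real \<Rightarrow> 'b::{real_normed_field,banach,second_countable_topology}"
  assumes "\<And>b. b \<in> Basis \<Longrightarrow> integrable lborel (f b)"
  shows "integrable lborel (\<lambda>x::'a. \<Prod>b\<in>Basis. f b (x \<bullet> b))"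
    and "(\<integral>x. (\<Prod>b\<in>Basis. f b (x \<bullet> b)) \<partial>(lborel :: 'a measure)) = (\<Prod>b\<in>Basis. integral\<^sup>L lborel (f b))"
proof -
  interpret product_sigma_finite "\<lambda>_::'a. lborel :: real measure" ..
  have [measurable]: "f b \<in> borel_measurable borel" if "b \<in> Basis" for b
    using borel_measurable_integrable[OF assms[OF that]] by simp
  have eq: "(\<Prod>b\<in>Basis. f b ((\<Sum>b\<in>Basis. g b *\<^sub>R b) \<bullet> b)) = (\<Prod>b\<in>Basis. f b (g b))" for g :: "'a \<Rightarrow> real"
    by (intro prod.cong refl) simp
  show "integrable lborel (\<lambda>x::'a. \<Prod>b\<in>Basis. f b (x \<bullet> b))"
    by (subst lborel_eq, subst integrable_distr_eq)
       (auto simp: eq intro!: product_integrable_prod assms)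
  show "(\<integral>x. (\<Prod>b\<in>Basis. f b (x \<bullet> b)) \<partial>(lborel :: 'a measure)) = (\<Prod>b\<in>Basis. integral\<^sup>L lborel (f b))"
    by (subst lborel_eq, subst integral_distr)
       (auto simp: eq product_integral_prod assms)
qed

lemma integrable_inverse_1_plus_square: "integrable lborel (\<lambda>x::real. inverse (1 + x\<^sup>2))"
  using Sinc_Integral.integrable_inverse_1_plus_square by (simp add: set_integrable_def)

lemma one_plus_norm_power2_ge_prod:
  "(\<Prod>b\<in>Basis. 1 + (x \<bullet> b)\<^sup>2) \<le> (1 + (norm x)\<^sup>2) ^ DIM('a)" for x :: "'a::euclidean_space"
proof -
  have "(\<Prod>b\<in>Basis. 1 + (x \<bullet> b)\<^sup>2) \<le> (\<Prod>b\<in>(Basis::'a set). 1 + (norm x)\<^sup>2)"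
  proof (intro prod_mono conjI)
    fix b :: 'a assume "b \<in> Basis"
    then have "\<bar>x \<bullet> b\<bar> \<le> norm x" by (rule Basis_le_norm)
    then have "\<bar>x \<bullet> b\<bar>\<^sup>2 \<le> (norm x)\<^sup>2" by (intro power_mono) auto
    then show "1 + (x \<bullet> b)\<^sup>2 \<le> 1 + (norm x)\<^sup>2" by simp
  qed (simp add: add_nonneg_nonneg)
  then show ?thesis by simp
qed

text \<open>Each coordinate is at most the norm, so a product of one-dimensional functions
  \<open>inverse (1 + t^2)\<close> is an integrable majorant.\<close>

lemma integrable_inverse_1_plus_norm_power:
  assumes "DIM('a) \<le> N"
  shows "integrable lborel (\<lambda>x::'a::euclidean_space. inverse ((1 + (norm x)\<^sup>2) ^ N))"
proof (rule Bochner_Integration.integrable_bound)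
  show "integrable lborel (\<lambda>x::'a. \<Prod>b\<in>Basis. inverse (1 + (x \<bullet> b)\<^sup>2))"
    by (rule lborel_product_integral) (rule integrable_inverse_1_plus_square)
  show "AE x::'a in lborel. norm (inverse ((1 + (norm x)\<^sup>2) ^ N)) \<le> norm (\<Prod>b\<in>Basis. inverse (1 + (x \<bullet> b)\<^sup>2))"
  proof (rule AE_I2)
    fix x :: 'a
    have "(\<Prod>b\<in>Basis. 1 + (x \<bullet> b)\<^sup>2) \<le> (1 + (norm x)\<^sup>2) ^ N"
      using one_plus_norm_power2_ge_prod[of x] power_increasing[OF assms, of "1 + (norm x)\<^sup>2"] by simp
    moreover have "0 < (\<Prod>b\<in>Basis. 1 + (x \<bullet> b)\<^sup>2)"
      by (intro prod_pos) (simp add: add_pos_nonneg)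
    ultimately show "norm (inverse ((1 + (norm x)\<^sup>2) ^ N)) \<le> norm (\<Prod>b\<in>Basis. inverse (1 + (x \<bullet> b)\<^sup>2))"
      using prod_inversef[of "\<lambda>b. 1 + (x \<bullet> b)\<^sup>2" "Basis :: 'a set"]
      by (simp add: le_imp_inverse_le comp_def)
  qed
qed simp

subsection \<open>Fourier transform of Gaussians\<close>

definition phase :: "real \<Rightarrow> complex" where
  "phase t = exp (2 * complex_of_real pi * \<i> * complex_of_real t)"

lemma norm_phase [simp]: "norm (phase t) = 1"
  by (simp add: phase_def norm_exp_eq_Re)

lemma phase_0 [simp]: "phase 0 = 1"
  by (simp add: phase_def)

lemma phase_add: "phase (s + t) = phase s * phase t"
  by (simp add: phase_def distrib_left exp_add)

lemma phase_diff: "phase (s - t) = phase s * phase (- t)"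
  using phase_add[of s "- t"] by simp

lemma phase_sum: "phase (\<Sum>i\<in>I. f i) = (\<Prod>i\<in>I. phase (f i))"
  by (induction I rule: infinite_finite_induct) (simp_all add: phase_add)

lemma continuous_on_phase [continuous_intros]:
  "continuous_on S f \<Longrightarrow> continuous_on S (\<lambda>x. phase (f x))"
  unfolding phase_def by (intro continuous_intros)

lemma borel_measurable_phase [measurable]: "phase \<in> borel_measurable borel"
  by (intro borel_measurable_continuous_onI continuous_intros)

lemma fourier_phase: "fourier f \<xi> = (LINT x|lborel. f x * phase (- (x \<bullet> \<xi>)))"
  unfolding fourier_def phase_def by simp

lemma inverse_fourier_phase: "inverse_fourier h x = (LINT \<xi>|lborel. h \<xi> * phase (x \<bullet> \<xi>))"
  unfolding inverse_fourier_def phase_def by simp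

lemma inverse_fourier_eq_fourier: "inverse_fourier h x = fourier h (- x)"
  by (simp add: inverse_fourier_phase fourier_phase inner_commute)

lemma integrable_mult_phase:
  assumes "integrable M f" and [measurable]: "g \<in> borel_measurable M"
  shows "integrable M (\<lambda>x. f x * phase (g x))"
  by (rule Bochner_Integration.integrable_bound[OF assms(1)])
     (use borel_measurable_integrable[OF assms(1)] in \<open>auto simp: norm_mult\<close>)

text \<open>This is the characteristic function of the standard normal law. Rescaling both variables
  by \<open>c = sqrt (2 * pi)\<close> turns its two Gaussians into the self-dual one.\<close>

lemma gaussian_fourier_real:
  "integrable lborel (\<lambda>x::real. complex_of_real (exp (- pi * x\<^sup>2)) * phase (x * y))"
  "(\<integral>x. complex_of_real (exp (- pi * x\<^sup>2)) * phase (x * y) \<partial>lborel) = complex_of_real (exp (- pi * y\<^sup>2))"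
proof -
  define c where "c = sqrt (2 * pi)"
  have c: "c > 0" "c\<^sup>2 = 2 * pi" by (auto simp: c_def)
  have *: "std_normal_density (c * x) = exp (- pi * x\<^sup>2) / c" for x
    unfolding std_normal_density_def by (simp add: power_mult_distrib c(2)) (simp add: c_def)
  have "integrable lborel (\<lambda>x. std_normal_density (c * x))"
    using lborel_integrable_real_affine[of std_normal_density c 0] c by simp
  then have "integrable lborel (\<lambda>x. c * std_normal_density (c * x))" by simp
  then have int: "integrable lborel (\<lambda>x. exp (- pi * x\<^sup>2))"
    unfolding * using c by simp
  then show "integrable lborel (\<lambda>x::real. complex_of_real (exp (- pi * x\<^sup>2)) * phase (x * y))"
    by (intro integrable_mult_phase integrable_of_real) simp_all
  have "complex_of_real (exp (- (c * y)\<^sup>2 / 2)) = char std_normal_distribution (c * y)"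
    by (simp add: char_std_normal_distribution)
  also have "\<dots> = (\<integral>x. std_normal_density x *\<^sub>R iexp (c * y * x) \<partial>lborel)"
    unfolding char_def by (subst integral_density) auto
  also have "\<dots> = c *\<^sub>R (\<integral>x. std_normal_density (c * x) *\<^sub>R iexp (c * y * (c * x)) \<partial>lborel)"
    using c by (subst lborel_integral_real_affine[of c _ 0]) auto
  also have "\<dots> = (\<integral>x. c *\<^sub>R std_normal_density (c * x) *\<^sub>R iexp (c * y * (c * x)) \<partial>lborel)"
    by (simp only: integral_scaleR_right)
  also have "\<dots> = (\<integral>x. complex_of_real (exp (- pi * x\<^sup>2)) * phase (x * y) \<partial>lborel)"
  proof (intro Bochner_Integration.integral_cong refl)
    fix x
    have "c * y * (c * x) = 2 * pi * (x * y)"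
      using c(2) by (simp add: power2_eq_square algebra_simps)
    then have "iexp (c * y * (c * x)) = phase (x * y)"
      by (simp only:) (simp add: phase_def algebra_simps)
    then show "c *\<^sub>R std_normal_density (c * x) *\<^sub>R iexp (c * y * (c * x))
        = complex_of_real (exp (- pi * x\<^sup>2)) * phase (x * y)"
      unfolding * using c by (simp add: scaleR_conv_of_real)
  qed
  finally show "(\<integral>x. complex_of_real (exp (- pi * x\<^sup>2)) * phase (x * y) \<partial>lborel)
      = complex_of_real (exp (- pi * y\<^sup>2))"
    by (simp add: power_mult_distrib c(2))
qed

lemma norm_power2_eq_sum: "(norm x)\<^sup>2 = (\<Sum>b\<in>Basis. (x \<bullet> b)\<^sup>2)" for x :: "'a::euclidean_space"
  by (subst power2_norm_eq_inner, subst euclidean_inner) (simp add: power2_eq_square)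

lemma gaussian_fourier_unit:
  fixes z :: "'a::euclidean_space"
  shows "integrable lborel (\<lambda>x::'a. complex_of_real (exp (- pi * (norm x)\<^sup>2)) * phase (x \<bullet> z))"
  "(\<integral>x. complex_of_real (exp (- pi * (norm x)\<^sup>2)) * phase (x \<bullet> z) \<partial>lborel)
     = complex_of_real (exp (- pi * (norm z)\<^sup>2))"
proof -
  have eq: "complex_of_real (exp (- pi * (norm x)\<^sup>2)) * phase (x \<bullet> z) =
     (\<Prod>b\<in>Basis. complex_of_real (exp (- pi * (x \<bullet> b)\<^sup>2)) * phase ((x \<bullet> b) * (z \<bullet> b)))" for x :: 'a
    by (subst euclidean_inner, subst norm_power2_eq_sum)
       (simp add: sum_distrib_left sum_negf[symmetric] exp_sum phase_sum prod.distrib)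
  show "integrable lborel (\<lambda>x::'a. complex_of_real (exp (- pi * (norm x)\<^sup>2)) * phase (x \<bullet> z))"
    unfolding eq by (rule lborel_product_integral) (rule gaussian_fourier_real)
  have "(\<integral>x. complex_of_real (exp (- pi * (norm x)\<^sup>2)) * phase (x \<bullet> z) \<partial>lborel)
     = (\<Prod>b\<in>Basis. complex_of_real (exp (- pi * (z \<bullet> b)\<^sup>2)))"
    unfolding eq by (subst lborel_product_integral) (simp_all only: gaussian_fourier_real)
  also have "\<dots> = complex_of_real (exp (- pi * (norm z)\<^sup>2))"
    by (subst norm_power2_eq_sum) (simp add: sum_distrib_left sum_negf[symmetric] exp_sum)
  finally show "(\<integral>x. complex_of_real (exp (- pi * (norm x)\<^sup>2)) * phase (x \<bullet> z) \<partial>lborel)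
     = complex_of_real (exp (- pi * (norm z)\<^sup>2))" .
qed

text \<open>The heat kernel at time \<open>t^2 / (4 * pi)\<close>, parametrised by its width so that
  its transform is \<open>exp (- pi * (t * norm \<xi>)^2)\<close>.\<close>

definition gauss_kernel :: "real \<Rightarrow> 'a::euclidean_space \<Rightarrow> real" where
  "gauss_kernel t z = exp (- pi * (norm z / t)\<^sup>2) / t ^ DIM('a)"

lemma gauss_kernel_nonneg: "0 < t \<Longrightarrow> 0 \<le> gauss_kernel t z"
  by (simp add: gauss_kernel_def)

lemma borel_measurable_gauss_kernel [measurable]:
  assumes [measurable]: "f \<in> borel_measurable M" "g \<in> borel_measurable M"
  shows "(\<lambda>x. gauss_kernel (f x) (g x :: 'a::euclidean_space)) \<in> borel_measurable M"
  unfolding gauss_kernel_def by measurable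

lemma fourier_gauss_kernel:
  fixes \<xi> :: "'a::euclidean_space"
  assumes t: "0 < t"
  shows "integrable lborel (\<lambda>x::'a. complex_of_real (gauss_kernel t x) * phase (x \<bullet> \<xi>))"
  "(\<integral>x. complex_of_real (gauss_kernel t x) * phase (x \<bullet> \<xi>) \<partial>lborel)
     = complex_of_real (exp (- pi * (t * norm \<xi>)\<^sup>2))"
proof -
  define f where "f x = complex_of_real (exp (- pi * (norm x)\<^sup>2)) * phase (x \<bullet> (t *\<^sub>R \<xi>))" for x :: 'a
  have f: "integrable lborel f" "integral\<^sup>L lborel f = complex_of_real (exp (- pi * (t * norm \<xi>)\<^sup>2))"
    unfolding f_def using gaussian_fourier_unit[of "t *\<^sub>R \<xi>"] t by simp_all
  have eq: "complex_of_real (gauss_kernel t x) * phase (x \<bullet> \<xi>) = complex_of_real (1 / t ^ DIM('a)) * f (0 + (1 / t) *\<^sub>R x)" for x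
    using t by (simp add: f_def gauss_kernel_def)
  show "integrable lborel (\<lambda>x::'a. complex_of_real (gauss_kernel t x) * phase (x \<bullet> \<xi>))"
    unfolding eq using t by (intro integrable_mult_right integrable_lborel_affine[OF f(1)]) simp
  have "integral\<^sup>L lborel f = (\<bar>1 / t\<bar> ^ DIM('a)) *\<^sub>R (\<integral>x. f (0 + (1 / t) *\<^sub>R x) \<partial>lborel)"
    by (rule integral_lborel_affine) (use t in simp)
  also have "\<dots> = (\<integral>x. complex_of_real (gauss_kernel t x) * phase (x \<bullet> \<xi>) \<partial>lborel)"
    unfolding eq using t by (simp add: scaleR_conv_of_real power_one_over)
  finally show "(\<integral>x. complex_of_real (gauss_kernel t x) * phase (x \<bullet> \<xi>) \<partial>lborel)
     = complex_of_real (exp (- pi * (t * norm \<xi>)\<^sup>2))"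
    by (simp add: f(2))
qed

lemma inverse_fourier_gaussian:
  fixes z :: "'a::euclidean_space"
  assumes t: "0 < t"
  shows "integrable lborel (\<lambda>\<xi>::'a. complex_of_real (exp (- pi * (t * norm \<xi>)\<^sup>2)) * phase (z \<bullet> \<xi>))"
  "(\<integral>\<xi>. complex_of_real (exp (- pi * (t * norm \<xi>)\<^sup>2)) * phase (z \<bullet> \<xi>) \<partial>lborel)
     = complex_of_real (gauss_kernel t z)"
proof -
  define f where "f x = complex_of_real (exp (- pi * (norm x)\<^sup>2)) * phase (x \<bullet> ((1 / t) *\<^sub>R z))" for x :: 'a
  have f: "integrable lborel f" "integral\<^sup>L lborel f = complex_of_real (exp (- pi * (norm z / t)\<^sup>2))"
    unfolding f_def using gaussian_fourier_unit[of "(1 / t) *\<^sub>R z"] t by simp_all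
  have eq: "complex_of_real (exp (- pi * (t * norm \<xi>)\<^sup>2)) * phase (z \<bullet> \<xi>) = f (0 + t *\<^sub>R \<xi>)" for \<xi>
    using t by (simp add: f_def inner_commute)
  show "integrable lborel (\<lambda>\<xi>::'a. complex_of_real (exp (- pi * (t * norm \<xi>)\<^sup>2)) * phase (z \<bullet> \<xi>))"
    unfolding eq using t by (intro integrable_lborel_affine[OF f(1)]) simp
  have "integral\<^sup>L lborel f = (\<bar>t\<bar> ^ DIM('a)) *\<^sub>R (\<integral>x. f (0 + t *\<^sub>R x) \<partial>lborel)"
    by (rule integral_lborel_affine) (use t in simp)
  then show "(\<integral>\<xi>. complex_of_real (exp (- pi * (t * norm \<xi>)\<^sup>2)) * phase (z \<bullet> \<xi>) \<partial>lborel)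
     = complex_of_real (gauss_kernel t z)"
    unfolding eq f(2) using t by (simp add: gauss_kernel_def scaleR_conv_of_real field_simps)
qed

lemma gauss_kernel_integral:
  assumes "0 < t"
  shows "integrable lborel (gauss_kernel t :: 'a::euclidean_space \<Rightarrow> real)"
    and "(\<integral>\<^sup>+z. ennreal (gauss_kernel t (z :: 'a)) \<partial>lborel) = 1"
proof -
  note * = fourier_gauss_kernel[OF assms, of "0 :: 'a"]
  show int: "integrable lborel (gauss_kernel t :: 'a \<Rightarrow> real)"
    using integrable_Re[OF *(1)] by simp
  have "complex_of_real (integral\<^sup>L lborel (gauss_kernel t :: 'a \<Rightarrow> real)) = 1"
    using *(2) by (simp add: integral_complex_of_real)
  then have "integral\<^sup>L lborel (gauss_kernel t :: 'a \<Rightarrow> real) = 1"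
    using of_real_eq_1_iff by blast
  then show "(\<integral>\<^sup>+z. ennreal (gauss_kernel t (z :: 'a)) \<partial>lborel) = 1"
    by (subst nn_integral_eq_integral[OF int]) (simp_all add: gauss_kernel_nonneg assms)
qed

subsection \<open>Fourier transform of Schwartz functions\<close>

text \<open>Phases have modulus 1, so most double integrals below have a product of two integrable
  functions as majorant, and Fubini's theorem applies at once.\<close>

lemma integrable_pair_dominated:
  fixes f :: "'a::euclidean_space \<Rightarrow> 'b::euclidean_space \<Rightarrow> complex"
  assumes a: "integrable lborel a" and b: "integrable lborel b"
    and [measurable]: "(\<lambda>(x, y). f x y) \<in> borel_measurable (lborel \<Otimes>\<^sub>M lborel)"
    and le: "\<And>x y. norm (f x y) \<le> a x * b y"
  shows "integrable (lborel \<Otimes>\<^sub>M lborel) (\<lambda>(x, y). f x y)"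
proof -
  have [measurable]: "a \<in> borel_measurable borel" "b \<in> borel_measurable borel"
    using a b by (auto dest: borel_measurable_integrable)
  have "integrable (lborel \<Otimes>\<^sub>M lborel) (\<lambda>z. a (fst z) * b (snd z) :: real)"
    using a b by (intro lborel_pair.Fubini_integrable) (auto simp: abs_mult)
  then show ?thesis
    by (rule Bochner_Integration.integrable_bound)
       (auto simp: split_beta intro!: AE_I2 order_trans[OF le abs_ge_self])
qed

lemma integral_swap_dominated:
  fixes f :: "'a::euclidean_space \<Rightarrow> 'b::euclidean_space \<Rightarrow> complex"
  assumes "integrable lborel a" "integrable lborel b"
    and "(\<lambda>(x, y). f x y) \<in> borel_measurable (lborel \<Otimes>\<^sub>M lborel)"
    and "\<And>x y. norm (f x y) \<le> a x * b y"
  shows "(LINT x|lborel. LINT y|lborel. f x y) = (LINT y|lborel. LINT x|lborel. f x y)"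
  using lborel_pair.Fubini_integral[OF integrable_pair_dominated[OF assms]] by simp

section \<open>Regularity and decay of Schwartz functions\<close>

lemma iter_deriv_Nil [simp]: "iter_deriv [] f = f"
  and iter_deriv_Cons: "iter_deriv (b # bs) f = (\<lambda>x. frechet_derivative (iter_deriv bs f) (at x) b)"
  and iter_deriv_append: "iter_deriv (as @ bs) f = iter_deriv as (iter_deriv bs f)"
  by (simp_all add: iter_deriv_def)

lemma schwartz_iter_deriv:
  assumes "schwartz f" "set bs \<subseteq> Basis"
  shows "schwartz (iter_deriv bs f)"
  unfolding schwartz_def iter_deriv_append[symmetric]
  using assms unfolding schwartz_def by (metis le_sup_iff set_append)

lemma schwartz_differentiable: "schwartz f \<Longrightarrow> f differentiable (at x)"
  unfolding schwartz_def using iter_deriv_Nil by (metis empty_set empty_subsetI)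

lemma schwartz_continuous: "schwartz f \<Longrightarrow> continuous_on S f"
  by (intro differentiable_imp_continuous_on)
     (auto simp: differentiable_on_def schwartz_differentiable intro: differentiable_at_withinI)

lemma schwartz_measurable: "schwartz f \<Longrightarrow> f \<in> borel_measurable borel"
  by (intro borel_measurable_continuous_onI schwartz_continuous)

lemma one_plus_square_power_le: "(1 + r\<^sup>2) ^ N \<le> 2 ^ N * (1 + r ^ (2 * N))" for r :: real
proof -
  have "(1 + r\<^sup>2) ^ N \<le> (2 * max 1 (r\<^sup>2)) ^ N" by (intro power_mono) auto
  also have "\<dots> = 2 ^ N * max 1 (r\<^sup>2) ^ N" by (simp add: power_mult_distrib)
  also have "max 1 (r\<^sup>2) ^ N \<le> 1 + r ^ (2 * N)"
    unfolding power_mult by (simp add: max_def)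
  finally show ?thesis by simp
qed

text \<open>The seminorm bounds for the exponents 0 and \<open>2 * N\<close> are added; together
  they control \<open>(1 + |x|^2)^N\<close> for small and for large x.\<close>

lemma schwartz_bound:
  assumes "schwartz f"
  obtains C where "C > 0" "\<And>x. norm (f x) \<le> C * inverse ((1 + (norm x)\<^sup>2) ^ N)"
proof -
  have "bounded (range (\<lambda>x. norm x ^ M *\<^sub>R f x))" for M
    using assms unfolding schwartz_def by (metis empty_set empty_subsetI iter_deriv_Nil)
  then have "\<exists>B. \<forall>x. norm x ^ M * norm (f x) \<le> B" for M
    unfolding bounded_iff by (simp add: norm_power)
  then obtain B where B: "\<And>M x. norm x ^ M * norm (f x) \<le> B M" by metis
  \<comment> \<open>The summand 1 keeps \<open>C\<close> positive even for f = 0.\<close>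
  define C where "C = 2 ^ N * (B 0 + B (2 * N)) + 1"
  have B0: "0 \<le> B M" for M using B[of 0 M] by (metis order_trans mult_nonneg_nonneg norm_ge_zero zero_le_power)
  have "C > 0" unfolding C_def using B0 by (intro add_nonneg_pos mult_nonneg_nonneg) auto
  moreover have "norm (f x) \<le> C * inverse ((1 + (norm x)\<^sup>2) ^ N)" for x
  proof -
    have "(1 + (norm x)\<^sup>2) ^ N * norm (f x) \<le> 2 ^ N * (1 + norm x ^ (2 * N)) * norm (f x)"
      by (intro mult_right_mono one_plus_square_power_le) auto
    also have "\<dots> = 2 ^ N * (norm x ^ 0 * norm (f x) + norm x ^ (2 * N) * norm (f x))"
      by (simp add: algebra_simps)
    also have "\<dots> \<le> C" unfolding C_def using B[of x 0] B[of x "2 * N"]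
      by (smt (verit) mult_left_mono zero_le_power)
    finally show ?thesis
      by (simp add: field_simps add_pos_nonneg)
  qed
  ultimately show ?thesis using that by blast
qed

lemma schwartz_integrable:
  fixes f :: "'a::euclidean_space \<Rightarrow> complex"
  assumes "schwartz f" shows "integrable lborel f"
proof -
  obtain C where C: "\<And>x. norm (f x) \<le> C * inverse ((1 + (norm x)\<^sup>2) ^ DIM('a))" "C > 0"
    using schwartz_bound[OF assms] by metis
  show ?thesis
  proof (rule Bochner_Integration.integrable_bound)
    show "integrable lborel (\<lambda>x::'a. C * inverse ((1 + (norm x)\<^sup>2) ^ DIM('a)))"
      by (intro integrable_mult_right integrable_inverse_1_plus_norm_power) simp
  qed (use C schwartz_measurable[OF assms] in \<open>auto intro!: AE_I2 order_trans[OF C(1) abs_ge_self]\<close>)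
qed

section \<open>Transforms of derivatives, decay of the transform, and inversion\<close>

lemma norm_fourier_le: "norm (fourier f \<xi>) \<le> (LINT x|lborel. norm (f x))"
  unfolding fourier_phase by (rule order_trans[OF integral_norm_bound]) (simp add: norm_mult)

lemma fourier_borel_measurable:
  assumes [measurable]: "f \<in> borel_measurable borel"
  shows "fourier f \<in> borel_measurable borel"
  unfolding fourier_phase[abs_def] by measurable

lemma borel_measurable_inverse_fourier:
  assumes "m \<in> borel_measurable borel"
  shows "inverse_fourier m \<in> borel_measurable borel"
proof -
  have "(\<lambda>x. fourier m (- x)) \<in> borel_measurable borel"
    by (rule measurable_compose[OF _ fourier_borel_measurable[OF assms]]) simp
  then show ?thesis
    by (simp add: inverse_fourier_eq_fourier[abs_def])
qed

lemma fourier_translation: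
  "fourier (\<lambda>x. f (x + a)) \<xi> = phase (a \<bullet> \<xi>) * fourier f \<xi>"
proof -
  have "fourier f \<xi> = (LINT x|lborel. f (a + 1 *\<^sub>R x) * phase (- ((a + 1 *\<^sub>R x) \<bullet> \<xi>)))"
    unfolding fourier_phase by (subst integral_lborel_affine[of 1 _ a]) simp_all
  also have "\<dots> = (LINT x|lborel. phase (- (a \<bullet> \<xi>)) * (f (x + a) * phase (- (x \<bullet> \<xi>))))"
    by (intro Bochner_Integration.integral_cong refl)
       (simp add: inner_add_left phase_diff mult_ac add.commute)
  also have "\<dots> = phase (- (a \<bullet> \<xi>)) * fourier (\<lambda>x. f (x + a)) \<xi>"
    unfolding fourier_phase by simp
  finally show ?thesis by (simp add: mult.assoc[symmetric] phase_add[symmetric])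
qed

lemma has_vector_derivative_along_line:
  fixes f :: "'a::real_normed_vector \<Rightarrow> 'b::real_normed_vector"
  assumes "f differentiable (at (x + u *\<^sub>R b))"
  shows "((\<lambda>u. f (x + u *\<^sub>R b)) has_vector_derivative frechet_derivative f (at (x + u *\<^sub>R b)) b) (at u)"
proof -
  have f': "(f has_derivative frechet_derivative f (at (x + u *\<^sub>R b))) (at (x + u *\<^sub>R b))"
    using assms frechet_derivative_works by blast
  have "((\<lambda>u. x + u *\<^sub>R b) has_derivative (\<lambda>h. h *\<^sub>R b)) (at u)"
    by (auto intro!: derivative_eq_intros)
  from has_derivative_compose[OF this f'] show ?thesis
    unfolding has_vector_derivative_def using linear_cmul[OF has_derivative_linear[OF f']] by simp
qed

lemma norm_translation_diff_le:
  fixes f :: "'a::euclidean_space \<Rightarrow> complex"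
  assumes diff: "\<And>y. f differentiable (at y)" and t: "0 \<le> t"
    and B: "\<And>u. 0 \<le> u \<Longrightarrow> u \<le> t \<Longrightarrow> norm (frechet_derivative f (at (x + u *\<^sub>R b)) b) \<le> B"
  shows "norm (f (x + t *\<^sub>R b) - f x) \<le> t * B"
proof -
  define g where "g u = f (x + u *\<^sub>R b)" for u
  define g' where "g' u = frechet_derivative f (at (x + u *\<^sub>R b)) b" for u
  have der: "(g has_derivative (\<lambda>h. h *\<^sub>R g' u)) (at u within {0..t})" for u
    using has_vector_derivative_along_line[OF diff, of x b u] has_vector_derivative_at_within
    unfolding g_def g'_def has_vector_derivative_def by blast
  have "norm (g t - g 0) \<le> B * norm (t - 0)"
  proof (rule differentiable_bound[OF _ der])
    fix u assume "u \<in> {0..t}"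
    then have "norm (g' u) \<le> B" using B by (simp add: g'_def)
    then show "onorm (\<lambda>h. h *\<^sub>R g' u) \<le> B"
      by (intro onorm_le) (simp add: mult.commute[of B] mult_left_mono)
  qed (use t in auto)
  then show ?thesis using t by (simp add: g_def mult.commute)
qed

lemma phase_difference_quotient:
  "(\<lambda>m. (phase (c / real (Suc m)) - 1) * real (Suc m)) \<longlonglongrightarrow> 2 * complex_of_real pi * \<i> * c"
proof -
  let ?k = "2 * complex_of_real pi * \<i> * c"
  have "((\<lambda>z. exp (z * ?k)) has_field_derivative ?k) (at 0)"
    by (auto intro!: derivative_eq_intros)
  then have lim: "((\<lambda>z. (exp (z * ?k) - 1) / z) \<longlongrightarrow> ?k) (at 0)"
    by (simp add: DERIV_def)
  have "(\<lambda>m. complex_of_real (1 / real (Suc m))) \<longlonglongrightarrow> complex_of_real 0"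
    by (intro tendsto_of_real) (use LIMSEQ_inverse_real_of_nat in \<open>simp add: inverse_eq_divide\<close>)
  then have "filterlim (\<lambda>m. complex_of_real (1 / real (Suc m))) (at 0) sequentially"
    by (auto simp: filterlim_at simp del: of_nat_Suc)
  from filterlim_compose[OF lim this] show ?thesis
    by (simp add: phase_def mult_ac divide_inverse)
qed

text \<open>Difference quotients take the place of integration by parts. A translation by
  \<open>t m\<close> along b multiplies the transform by a phase, so the transform of the quotient
  is explicit; the quotient itself converges under a common majorant.\<close>

lemma fourier_frechet_derivative:
  fixes f :: "'a::euclidean_space \<Rightarrow> complex"
  assumes f: "schwartz f" and b: "b \<in> Basis"
  shows "fourier (iter_deriv [b] f) \<xi> = 2 * complex_of_real pi * \<i> * complex_of_real (b \<bullet> \<xi>) * fourier f \<xi>"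
proof -
  define N where "N = DIM('a)"
  define D where "D = iter_deriv [b] f"
  have D_eq: "D x = frechet_derivative f (at x) b" for x by (simp add: D_def iter_deriv_Cons)
  have D: "schwartz D" unfolding D_def using b by (intro schwartz_iter_deriv[OF f]) simp
  note [measurable] = schwartz_measurable[OF f] schwartz_measurable[OF D]
  obtain C where C: "C > 0" "\<And>x. norm (D x) \<le> C * inverse ((1 + (norm x)\<^sup>2) ^ N)"
    using schwartz_bound[OF D] by metis
  define t where "t m = 1 / real (Suc m)" for m
  have t: "0 < t m" "t m \<le> 1" for m by (auto simp: t_def field_simps)
  define s where "s m x = (f (x + t m *\<^sub>R b) - f x) * real (Suc m) * phase (- (x \<bullet> \<xi>))" for m x
  have int_s: "integral\<^sup>L lborel (s m) = (phase ((b \<bullet> \<xi>) / real (Suc m)) - 1) * real (Suc m) * fourier f \<xi>" for m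
  proof -
    have i: "integrable lborel f" by (rule schwartz_integrable[OF f])
    then have i': "integrable lborel (\<lambda>x. f (x + t m *\<^sub>R b))"
      using integrable_lborel_affine[OF i, of 1 "t m *\<^sub>R b"] by (simp add: add.commute)
    have "integral\<^sup>L lborel (s m) = (LINT x|lborel. real (Suc m) * (f (x + t m *\<^sub>R b) * phase (- (x \<bullet> \<xi>)) - f x * phase (- (x \<bullet> \<xi>))))"
      by (intro Bochner_Integration.integral_cong refl) (simp add: s_def algebra_simps del: of_nat_Suc)
    also have "\<dots> = real (Suc m) * (fourier (\<lambda>x. f (x + t m *\<^sub>R b)) \<xi> - fourier f \<xi>)"
      unfolding fourier_phase using i i' by (simp add: integrable_mult_phase)
    also have "\<dots> = (phase ((b \<bullet> \<xi>) / real (Suc m)) - 1) * real (Suc m) * fourier f \<xi>"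
      unfolding fourier_translation by (simp add: t_def algebra_simps)
    finally show ?thesis .
  qed
  have "(\<lambda>m. integral\<^sup>L lborel (s m)) \<longlonglongrightarrow> integral\<^sup>L lborel (\<lambda>x. D x * phase (- (x \<bullet> \<xi>)))"
  proof (rule integral_dominated_convergence)
    show "integrable lborel (\<lambda>x::'a. C * 3 ^ N * inverse ((1 + (norm x)\<^sup>2) ^ N))"
      by (intro integrable_mult_right integrable_inverse_1_plus_norm_power) (simp add: N_def)
    show "AE x in lborel. (\<lambda>m. s m x) \<longlonglongrightarrow> D x * phase (- (x \<bullet> \<xi>))"
    proof (rule AE_I2)
      fix x
      have v: "((\<lambda>u. f (x + u *\<^sub>R b)) has_vector_derivative D x) (at 0)"
        using has_vector_derivative_along_line[of f x 0 b] schwartz_differentiable[OF f] by (simp add: D_eq)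
      have lim: "((\<lambda>u. (f (x + u *\<^sub>R b) - f x) /\<^sub>R u) \<longlongrightarrow> D x) (at 0)"
      proof -
        have "((\<lambda>u. norm ((f (x + u *\<^sub>R b) - f x) /\<^sub>R u - D x)) \<longlongrightarrow> 0) (at 0)"
        proof (rule Lim_transform_eventually)
          show "((\<lambda>u. norm (f (x + u *\<^sub>R b) - f x - u *\<^sub>R D x) / norm u) \<longlongrightarrow> 0) (at 0)"
            using v by (simp add: has_vector_derivative_def has_derivative_iff_norm)
          show "\<forall>\<^sub>F u in at 0. norm (f (x + u *\<^sub>R b) - f x - u *\<^sub>R D x) / norm u
              = norm ((f (x + u *\<^sub>R b) - f x) /\<^sub>R u - D x)"
          proof (rule eventually_at_filter[THEN iffD2, OF always_eventually], intro allI impI)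
            fix u :: real assume "u \<noteq> 0"
            then have "(f (x + u *\<^sub>R b) - f x) /\<^sub>R u - D x = (f (x + u *\<^sub>R b) - f x - u *\<^sub>R D x) /\<^sub>R u"
              by (simp add: algebra_simps)
            then show "norm (f (x + u *\<^sub>R b) - f x - u *\<^sub>R D x) / norm u
                = norm ((f (x + u *\<^sub>R b) - f x) /\<^sub>R u - D x)"
              by (simp add: divide_inverse mult.commute)
          qed
        qed
        then show ?thesis by (simp add: tendsto_norm_zero_iff LIM_zero_iff)
      qed
      have "t \<longlonglongrightarrow> 0" unfolding t_def[abs_def]
        using LIMSEQ_inverse_real_of_nat by (simp add: inverse_eq_divide)
      then have "filterlim t (at 0) sequentially"
        using t by (auto simp: filterlim_at intro!: always_eventually less_imp_neq[symmetric])
      from filterlim_compose[OF lim this]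
      have "(\<lambda>m. (f (x + t m *\<^sub>R b) - f x) * real (Suc m)) \<longlonglongrightarrow> D x"
        by (simp add: t_def scaleR_conv_of_real mult_ac)
      then show "(\<lambda>m. s m x) \<longlonglongrightarrow> D x * phase (- (x \<bullet> \<xi>))"
        unfolding s_def by (intro tendsto_mult tendsto_const)
    qed
    show "AE x in lborel. norm (s m x) \<le> C * 3 ^ N * inverse ((1 + (norm x)\<^sup>2) ^ N)" for m
    proof (rule AE_I2)
      fix x
      have "norm (f (x + t m *\<^sub>R b) - f x) \<le> t m * (C * 3 ^ N * inverse ((1 + (norm x)\<^sup>2) ^ N))"
      proof (rule norm_translation_diff_le)
        \<comment> \<open>Every point y of the segment is within distance 1 of x, because b is a
          unit vector and \<open>t m \<le> 1\<close>. Hence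
          \<open>1 + |x|^2 \<le> 3 * (1 + |y|^2)\<close>, which is the source of
          \<open>3 ^ N\<close>.\<close>
        fix u assume u: "0 \<le> u" "u \<le> t m"
        define y where "y = x + u *\<^sub>R b"
        have "norm x \<le> norm y + norm (u *\<^sub>R b)"
          unfolding y_def by (metis add_diff_cancel_right' norm_triangle_ineq4)
        also have "norm (u *\<^sub>R b) \<le> 1" using u t[of m] b by simp
        finally have "(norm x)\<^sup>2 \<le> (norm y + 1)\<^sup>2" by (intro power_mono) auto
        also have "\<dots> \<le> 2 * (norm y)\<^sup>2 + 2"
          using zero_le_power2[of "norm y - 1"] by (simp add: power2_eq_square algebra_simps)
        finally have x_le: "(norm x)\<^sup>2 \<le> 2 * (norm y)\<^sup>2 + 2" .
        have "1 + p \<le> 3 * (1 + q)" if "p \<le> 2 * q + 2" "0 \<le> q" for p q :: real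
          using that by simp
        from this[OF x_le] have "1 + (norm x)\<^sup>2 \<le> 3 * (1 + (norm y)\<^sup>2)" by simp
        then have "(1 + (norm x)\<^sup>2) ^ N \<le> 3 ^ N * (1 + (norm y)\<^sup>2) ^ N"
          unfolding power_mult_distrib[symmetric] by (intro power_mono) auto
        then have "inverse ((1 + (norm y)\<^sup>2) ^ N) \<le> 3 ^ N * inverse ((1 + (norm x)\<^sup>2) ^ N)"
          by (simp add: field_simps add_pos_nonneg)
        then show "norm (frechet_derivative f (at (x + u *\<^sub>R b)) b) \<le> C * 3 ^ N * inverse ((1 + (norm x)\<^sup>2) ^ N)"
          using C(2)[of y] C(1) unfolding D_eq y_def[symmetric]
          by (metis (no_types, opaque_lifting) mult.assoc mult_le_cancel_left_pos order_trans)
      qed (use schwartz_differentiable[OF f] t[of m] in auto)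
      from mult_right_mono[OF this, of "real (Suc m)"]
      have "norm (f (x + t m *\<^sub>R b) - f x) * real (Suc m) \<le> C * 3 ^ N * inverse ((1 + (norm x)\<^sup>2) ^ N)"
        by (simp add: t_def del: of_nat_Suc)
      moreover have "norm (s m x) = norm (f (x + t m *\<^sub>R b) - f x) * real (Suc m)"
        unfolding s_def norm_mult by (simp del: of_nat_Suc)
      ultimately show "norm (s m x) \<le> C * 3 ^ N * inverse ((1 + (norm x)\<^sup>2) ^ N)"
        by simp
    qed
  qed (simp_all add: s_def[abs_def])
  moreover have "(\<lambda>m. integral\<^sup>L lborel (s m)) \<longlonglongrightarrow> 2 * complex_of_real pi * \<i> * complex_of_real (b \<bullet> \<xi>) * fourier f \<xi>"
    unfolding int_s by (intro tendsto_mult phase_difference_quotient tendsto_const)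
  ultimately show ?thesis
    unfolding D_def[symmetric] fourier_phase[of D] by (rule LIMSEQ_unique)
qed

text \<open>Each derivative along b produces a factor of modulus
  \<open>2 * pi * |b \<bullet> \<xi>|\<close>, and the transform of the N-th derivative is bounded
  by an L^1 norm. The factor \<open>2 * pi\<close> is at least 1 and is dropped.\<close>

lemma fourier_schwartz_coordinate_bound:
  fixes f :: "'a::euclidean_space \<Rightarrow> complex"
  assumes f: "schwartz f" and b: "b \<in> Basis"
  shows "\<exists>C. \<forall>\<xi>. \<bar>b \<bullet> \<xi>\<bar> ^ N * norm (fourier f \<xi>) \<le> C"
proof -
  let ?k = "\<lambda>\<xi>. 2 * complex_of_real pi * \<i> * complex_of_real (b \<bullet> \<xi>)"
  have eq: "fourier (iter_deriv (replicate N b) f) \<xi> = ?k \<xi> ^ N * fourier f \<xi>" for \<xi>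
  proof (induction N)
    case (Suc N)
    have "schwartz (iter_deriv (replicate N b) f)"
      using b by (intro schwartz_iter_deriv f) auto
    from fourier_frechet_derivative[OF this b] show ?case
      using Suc iter_deriv_append[of "[b]" "replicate N b" f] by simp
  qed simp
  have "\<bar>b \<bullet> \<xi>\<bar> ^ N * norm (fourier f \<xi>) \<le> (LINT x|lborel. norm (iter_deriv (replicate N b) f x))" for \<xi>
  proof -
    have "\<bar>b \<bullet> \<xi>\<bar> ^ N * norm (fourier f \<xi>) \<le> norm (?k \<xi>) ^ N * norm (fourier f \<xi>)"
      using pi_ge_two by (intro mult_right_mono power_mono) (auto simp: norm_mult mult_le_cancel_right1)
    also have "\<dots> = norm (fourier (iter_deriv (replicate N b) f) \<xi>)"
      by (simp add: eq norm_mult norm_power)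
    also have "\<dots> \<le> (LINT x|lborel. norm (iter_deriv (replicate N b) f x))"
      by (rule norm_fourier_le)
    finally show ?thesis .
  qed
  then show ?thesis by blast
qed

lemma fourier_schwartz_bound:
  fixes f :: "'a::euclidean_space \<Rightarrow> complex"
  assumes f: "schwartz f"
  obtains C where "C > 0" "\<And>\<xi>. norm (fourier f \<xi>) \<le> C * inverse ((1 + (norm \<xi>)\<^sup>2) ^ N)"
proof -
  define d where "d = real DIM('a)"
  obtain B where B: "\<And>b \<xi>. b \<in> Basis \<Longrightarrow> \<bar>b \<bullet> \<xi>\<bar> ^ (2 * N) * norm (fourier f \<xi>) \<le> B b"
    using fourier_schwartz_coordinate_bound[OF f, of _ "2 * N"] by metis
  define A where "A = (LINT x|lborel. norm (f x))"
  have A: "norm (fourier f \<xi>) \<le> A" for \<xi> unfolding A_def by (rule norm_fourier_le)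
  have B0: "0 \<le> B b" if "b \<in> Basis" for b
    using B[OF that, of 0] by (rule order_trans[rotated]) simp
  have A0: "0 \<le> A" using A[of 0] by (rule order_trans[rotated]) simp
  define C where "C = 2 ^ N * (A + d ^ (2 * N) * (\<Sum>b\<in>Basis. B b)) + 1"
  have "C > 0" unfolding C_def d_def using A0 B0
    by (intro add_nonneg_pos mult_nonneg_nonneg add_nonneg_nonneg sum_nonneg) auto
  moreover have "norm (fourier f \<xi>) \<le> C * inverse ((1 + (norm \<xi>)\<^sup>2) ^ N)" for \<xi>
  proof -
    define F where "F = norm (fourier f \<xi>)"
    have F0: "0 \<le> F" by (simp add: F_def)
    \<comment> \<open>Pigeonhole: the d coordinates have absolute values summing to at least the
      norm, so one of them is at least the norm divided by d. Thus pure powers of single coordinates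
      control the norm.\<close>
    have "\<exists>b\<in>Basis. norm \<xi> \<le> d * \<bar>b \<bullet> \<xi>\<bar>"
    proof (rule ccontr)
      assume "\<not> ?thesis"
      then have "\<And>b. b \<in> Basis \<Longrightarrow> d * \<bar>\<xi> \<bullet> b\<bar> < norm \<xi>" by (auto simp: inner_commute not_le)
      then have "(\<Sum>b\<in>(Basis::'a set). d * \<bar>\<xi> \<bullet> b\<bar>) < (\<Sum>b\<in>(Basis::'a set). norm \<xi>)"
        by (intro sum_strict_mono) auto
      also have "\<dots> = d * norm \<xi>" by (simp add: d_def)
      also have "\<dots> \<le> d * (\<Sum>b\<in>Basis. \<bar>\<xi> \<bullet> b\<bar>)"
        by (intro mult_left_mono norm_le_l1) (simp add: d_def)
      finally show False by (simp add: sum_distrib_left)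
    qed
    then obtain b where b: "b \<in> Basis" "norm \<xi> \<le> d * \<bar>b \<bullet> \<xi>\<bar>" by blast
    have "norm \<xi> ^ (2 * N) * F \<le> (d * \<bar>b \<bullet> \<xi>\<bar>) ^ (2 * N) * F"
      using b F0 by (intro mult_right_mono power_mono) auto
    also have "\<dots> = d ^ (2 * N) * (\<bar>b \<bullet> \<xi>\<bar> ^ (2 * N) * F)" by (simp only: power_mult_distrib mult.assoc)
    also have "\<dots> \<le> d ^ (2 * N) * B b"
      unfolding F_def by (intro mult_left_mono B b) (simp add: d_def)
    also have "\<dots> \<le> d ^ (2 * N) * (\<Sum>b\<in>Basis. B b)"
      using b B0 by (intro mult_left_mono member_le_sum) (auto simp: d_def)
    finally have 1: "norm \<xi> ^ (2 * N) * F \<le> d ^ (2 * N) * (\<Sum>b\<in>Basis. B b)" .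
    have "(1 + (norm \<xi>)\<^sup>2) ^ N * F \<le> 2 ^ N * (1 + norm \<xi> ^ (2 * N)) * F"
      by (intro mult_right_mono one_plus_square_power_le F0)
    also have "\<dots> = 2 ^ N * (F + norm \<xi> ^ (2 * N) * F)" by (simp add: algebra_simps)
    also have "\<dots> \<le> 2 ^ N * (A + d ^ (2 * N) * (\<Sum>b\<in>Basis. B b))"
      using 1 A[of \<xi>] unfolding F_def by (intro mult_left_mono add_mono) auto
    also have "\<dots> \<le> C" by (simp add: C_def)
    finally show ?thesis unfolding F_def
      by (simp add: field_simps add_pos_nonneg)
  qed
  ultimately show ?thesis using that by blast
qed

lemma fourier_schwartz_integrable:
  fixes f :: "'a::euclidean_space \<Rightarrow> complex"
  assumes f: "schwartz f"
  shows "integrable lborel (\<lambda>\<xi>. norm \<xi> ^ k * norm (fourier f \<xi>))"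
proof -
  \<comment> \<open>Of the exponent \<open>DIM('a) + k\<close>, the part \<open>k\<close> absorbs
    \<open>norm \<xi> ^ k\<close> and the part \<open>DIM('a)\<close> leaves an integrable
    function.\<close>
  obtain C where C: "C > 0" "\<And>\<xi>. norm (fourier f \<xi>) \<le> C * inverse ((1 + (norm \<xi>)\<^sup>2) ^ (DIM('a) + k))"
    using fourier_schwartz_bound[OF f] by metis
  note [measurable] = fourier_borel_measurable[OF schwartz_measurable[OF f]]
  show ?thesis
  proof (rule Bochner_Integration.integrable_bound)
    show "integrable lborel (\<lambda>x::'a. C * inverse ((1 + (norm x)\<^sup>2) ^ DIM('a)))"
      by (intro integrable_mult_right integrable_inverse_1_plus_norm_power) simp
    show "AE \<xi> in lborel. norm (norm \<xi> ^ k * norm (fourier f \<xi>)) \<le> norm (C * inverse ((1 + (norm \<xi>)\<^sup>2) ^ DIM('a)))"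
    proof (rule AE_I2)
      fix \<xi> :: 'a
      have "norm \<xi> \<le> 1 + (norm \<xi>)\<^sup>2"
        using zero_le_power2[of "norm \<xi> - 1 / 2"]
        unfolding power2_diff by (simp add: power2_eq_square)
      then have "norm \<xi> ^ k \<le> (1 + (norm \<xi>)\<^sup>2) ^ k" by (intro power_mono) auto
      then have "norm \<xi> ^ k * norm (fourier f \<xi>) \<le> (1 + (norm \<xi>)\<^sup>2) ^ k * (C * inverse ((1 + (norm \<xi>)\<^sup>2) ^ (DIM('a) + k)))"
        by (intro mult_mono C) auto
      also have "\<dots> = C * inverse ((1 + (norm \<xi>)\<^sup>2) ^ DIM('a))"
        using add_pos_nonneg[OF zero_less_one zero_le_power2[of "norm \<xi>"]]
        by (simp add: power_add field_simps)
      finally show "norm (norm \<xi> ^ k * norm (fourier f \<xi>)) \<le> norm (C * inverse ((1 + (norm \<xi>)\<^sup>2) ^ DIM('a)))"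
        using C(1) by simp
    qed
  qed simp
qed

text \<open>The Gaussian damping \<open>E m\<close> makes the double integral absolutely convergent.
  The damped integral \<open>A m\<close> then has two limits as the width tends to 0: the inversion
  integral by dominated convergence, and f(x) because the exchanged integral is an average of f
  around x.\<close>

lemma schwartz_fourier_inversion:
  fixes f :: "'a::euclidean_space \<Rightarrow> complex"
  assumes f: "schwartz f"
  shows "inverse_fourier (fourier f) x = f x"
proof -
  note [measurable] = schwartz_measurable[OF f] fourier_borel_measurable[OF schwartz_measurable[OF f]]
  define t where "t m = 1 / real (Suc m)" for m
  have t: "0 < t m" for m by (auto simp: t_def)
  have t_lim: "t \<longlonglongrightarrow> 0"
    unfolding t_def[abs_def] using LIMSEQ_inverse_real_of_nat by (simp add: inverse_eq_divide)
  define E where "E m \<xi> = complex_of_real (exp (- pi * (t m * norm \<xi>)\<^sup>2))" for m and \<xi> :: 'a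
  have [measurable]: "E m \<in> borel_measurable borel" for m unfolding E_def[abs_def] by measurable
  have E_le: "norm (E m \<xi>) \<le> 1" for m \<xi> by (simp add: E_def)
  have f_int: "integrable lborel f" by (rule schwartz_integrable[OF f])
  have F_int: "integrable lborel (\<lambda>\<xi>. norm (fourier f \<xi>))"
    using fourier_schwartz_integrable[OF f, of 0] by simp
  have E_int: "integrable lborel (\<lambda>\<xi>. norm (E m \<xi>))" for m
    using integrable_norm[OF inverse_fourier_gaussian(1)[OF t[of m], of "0 :: 'a"]] by (simp add: E_def)
  define A where "A m = (LINT \<xi>|lborel. E m \<xi> * fourier f \<xi> * phase (x \<bullet> \<xi>))" for m
  have "A \<longlonglongrightarrow> (LINT \<xi>|lborel. 1 * fourier f \<xi> * phase (x \<bullet> \<xi>))"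
    unfolding A_def
  proof (rule integral_dominated_convergence[OF _ _ F_int])
    have "(\<lambda>m. complex_of_real (exp (- pi * (t m * norm \<xi>)\<^sup>2))) \<longlonglongrightarrow> complex_of_real (exp (- pi * (0 * norm \<xi>)\<^sup>2))" for \<xi> :: 'a
      by (intro tendsto_intros t_lim)
    then show "AE \<xi> in lborel. (\<lambda>m. E m \<xi> * fourier f \<xi> * phase (x \<bullet> \<xi>)) \<longlonglongrightarrow> 1 * fourier f \<xi> * phase (x \<bullet> \<xi>)"
      by (intro AE_I2 tendsto_mult tendsto_const) (simp add: E_def)
    show "AE \<xi> in lborel. norm (E m \<xi> * fourier f \<xi> * phase (x \<bullet> \<xi>)) \<le> norm (fourier f \<xi>)" for m
      using E_le by (intro AE_I2) (simp add: norm_mult mult_left_le_one_le)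
  qed measurable
  then have lim1: "A \<longlonglongrightarrow> inverse_fourier (fourier f) x"
    by (simp add: inverse_fourier_phase)
  have A_eq: "A m = (LINT z|lborel. complex_of_real (gauss_kernel 1 z) * f (x - t m *\<^sub>R z))" for m
  proof -
    have "A m = (LINT \<xi>|lborel. LINT y|lborel. E m \<xi> * (f y * phase (- (y \<bullet> \<xi>))) * phase (x \<bullet> \<xi>))"
      unfolding A_def fourier_phase by (simp only: integral_mult_left_zero integral_mult_right_zero)
    also have "\<dots> = (LINT y|lborel. LINT \<xi>|lborel. E m \<xi> * (f y * phase (- (y \<bullet> \<xi>))) * phase (x \<bullet> \<xi>))"
      by (rule integral_swap_dominated[OF E_int[of m] integrable_norm[OF f_int]])
         (simp_all add: norm_mult)
    also have "\<dots> = (LINT y|lborel. f y * (LINT \<xi>|lborel. E m \<xi> * phase ((x - y) \<bullet> \<xi>)))"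
      unfolding integral_mult_right_zero[symmetric]
      by (intro Bochner_Integration.integral_cong refl) (simp add: inner_diff_left phase_diff mult_ac)
    also have "\<dots> = (LINT y|lborel. f y * complex_of_real (gauss_kernel (t m) (x - y)))"
      unfolding E_def inverse_fourier_gaussian(2)[OF t] ..
    \<comment> \<open>The substitution y = x - (t m) z turns the kernel of width \<open>t m\<close>
      into the fixed kernel of width 1; afterwards m occurs only in the argument of f.\<close>
    also have "\<dots> = (\<bar>- t m\<bar> ^ DIM('a)) *\<^sub>R (LINT z|lborel. f (x + (- t m) *\<^sub>R z)
        * complex_of_real (gauss_kernel (t m) (x - (x + (- t m) *\<^sub>R z))))"
      by (rule integral_lborel_affine) (use t[of m] in simp)
    also have "\<dots> = (LINT z|lborel. (t m ^ DIM('a)) *\<^sub>R (f (x + (- t m) *\<^sub>R z)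
        * complex_of_real (gauss_kernel (t m) (x - (x + (- t m) *\<^sub>R z)))))"
      using t[of m] by (subst integral_scaleR_right) simp
    also have "\<dots> = (LINT z|lborel. complex_of_real (gauss_kernel 1 z) * f (x - t m *\<^sub>R z))"
    proof (intro Bochner_Integration.integral_cong refl)
      fix z :: 'a
      have "gauss_kernel (t m) (t m *\<^sub>R z) * t m ^ DIM('a) = gauss_kernel 1 z"
        using t[of m] by (simp add: gauss_kernel_def)
      then show "(t m ^ DIM('a)) *\<^sub>R (f (x + (- t m) *\<^sub>R z) * complex_of_real (gauss_kernel (t m) (x - (x + (- t m) *\<^sub>R z))))
          = complex_of_real (gauss_kernel 1 z) * f (x - t m *\<^sub>R z)"
        by (simp add: scaleR_conv_of_real mult_ac flip: of_real_mult of_real_power)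
    qed
    finally show ?thesis .
  qed
  obtain B where B: "\<And>x. norm (f x) \<le> B"
    using schwartz_bound[OF f, of 0] by auto
  have "A \<longlonglongrightarrow> (LINT z|(lborel :: 'a measure). complex_of_real (gauss_kernel 1 z) * f x)"
    unfolding A_eq[abs_def]
  proof (rule integral_dominated_convergence)
    show "integrable lborel (\<lambda>z::'a. gauss_kernel 1 z * B)"
      by (intro integrable_mult_left gauss_kernel_integral) simp
    have "isCont f x"
      using schwartz_continuous[OF f, of UNIV] by (simp add: continuous_on_eq_continuous_at)
    moreover have "(\<lambda>m. x - t m *\<^sub>R z) \<longlonglongrightarrow> x - 0 *\<^sub>R z" for z by (intro tendsto_intros t_lim)
    ultimately have "(\<lambda>m. f (x - t m *\<^sub>R z)) \<longlonglongrightarrow> f x" for z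
      using isCont_tendsto_compose by fastforce
    then show "AE z in lborel. (\<lambda>m. complex_of_real (gauss_kernel 1 z) * f (x - t m *\<^sub>R z)) \<longlonglongrightarrow> complex_of_real (gauss_kernel 1 z) * f x"
      by (intro AE_I2 tendsto_mult tendsto_const)
    show "AE z in lborel. norm (complex_of_real (gauss_kernel 1 z) * f (x - t m *\<^sub>R z)) \<le> gauss_kernel 1 z * B" for m
      by (intro AE_I2) (simp add: norm_mult gauss_kernel_nonneg mult_left_mono B)
  qed measurable
  also have "(LINT z|(lborel :: 'a measure). complex_of_real (gauss_kernel 1 z) * f x) = f x"
    using fourier_gauss_kernel(2)[of 1 "0 :: 'a"] by simp
  finally show ?thesis using lim1 LIMSEQ_unique by blast
qed

subsection \<open>Gaussian kernels and subordination\<close>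

text \<open>By the parallelogram law the geometric mean of two translated Gaussians is a Gaussian
  centred at the midpoint. Its mass, the factor in front, is the Hellinger affinity of the
  two.\<close>

lemma gauss_kernel_half_product:
  fixes z h :: "'a::euclidean_space"
  assumes t: "0 < t"
  shows "sqrt (gauss_kernel t (z - h)) * sqrt (gauss_kernel t z)
    = exp (- pi * (norm h / t)\<^sup>2 / 4) * gauss_kernel t (z - h /\<^sub>R 2)"
proof -
  have par: "(norm (z - h))\<^sup>2 + (norm z)\<^sup>2 = 2 * (norm (z - h /\<^sub>R 2))\<^sup>2 + (norm h)\<^sup>2 / 2"
    by (simp add: power2_norm_eq_inner inner_simps algebra_simps inner_commute)
  have "sqrt (gauss_kernel t (z - h)) * sqrt (gauss_kernel t z) = sqrt (gauss_kernel t (z - h) * gauss_kernel t z)"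
    by (simp add: real_sqrt_mult)
  also have "gauss_kernel t (z - h) * gauss_kernel t z =
     (exp (- pi * (norm h / t)\<^sup>2 / 4) * gauss_kernel t (z - h /\<^sub>R 2))\<^sup>2"
  proof -
    have "- pi * (norm (z - h) / t)\<^sup>2 + - pi * (norm z / t)\<^sup>2 = - pi * (((norm (z - h))\<^sup>2 + (norm z)\<^sup>2) / t\<^sup>2)"
      by (simp add: power_divide add_divide_distrib algebra_simps)
    also have "\<dots> = 2 * (- pi * (norm h / t)\<^sup>2 / 4 + - pi * (norm (z - h /\<^sub>R 2) / t)\<^sup>2)"
      unfolding par by (simp add: power_divide add_divide_distrib algebra_simps)
    finally show ?thesis
      unfolding gauss_kernel_def power_mult_distrib power_divide
      by (simp add: exp_add[symmetric] exp_double[symmetric] power2_eq_square[of "t ^ DIM('a)"])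
  qed
  also have "sqrt \<dots> = exp (- pi * (norm h / t)\<^sup>2 / 4) * gauss_kernel t (z - h /\<^sub>R 2)"
    by (rule real_sqrt_unique) (simp_all add: gauss_kernel_nonneg[OF t])
  finally show ?thesis .
qed

lemma nn_integral_gauss_kernel_diff_le_2:
  fixes h :: "'a::euclidean_space"
  assumes t: "0 < t"
  shows "(\<integral>\<^sup>+z. ennreal \<bar>gauss_kernel t (z - h) - gauss_kernel t z\<bar> \<partial>lborel) \<le> 2"
proof -
  have "(\<integral>\<^sup>+z. ennreal \<bar>gauss_kernel t (z - h) - gauss_kernel t z\<bar> \<partial>lborel)
    \<le> (\<integral>\<^sup>+z. ennreal (gauss_kernel t (z - h)) + ennreal (gauss_kernel t z) \<partial>lborel)"
  proof (intro nn_integral_mono)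
    fix z
    have "\<bar>gauss_kernel t (z - h) - gauss_kernel t z\<bar> \<le> gauss_kernel t (z - h) + gauss_kernel t z"
      using gauss_kernel_nonneg[OF t, of z] gauss_kernel_nonneg[OF t, of "z - h"] by linarith
    then show "ennreal \<bar>gauss_kernel t (z - h) - gauss_kernel t z\<bar> \<le> ennreal (gauss_kernel t (z - h)) + ennreal (gauss_kernel t z)"
      using gauss_kernel_nonneg[OF t] by (simp flip: ennreal_plus add: ennreal_leI)
  qed
  also have "\<dots> = 1 + 1"
    using nn_integral_lborel_translation[of "\<lambda>z. ennreal (gauss_kernel t z)" h]
    by (subst nn_integral_add) (auto simp: gauss_kernel_integral[OF t])
  finally show ?thesis by simp
qed

text \<open>With \<open>a\<^sup>2\<close> and \<open>b\<^sup>2\<close> the two translates, \<open>|a\<^sup>2 - b\<^sup>2| \<le> (l/2) (a - b)\<^sup>2 + (a + b)\<^sup>2 / (2 l)\<close>, where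
  \<open>l = t / |h|\<close>; the integral of \<open>a b\<close> is \<open>exp (- \<pi> |h|\<^sup>2 / (4 t\<^sup>2))\<close>.\<close>

lemma nn_integral_gauss_kernel_diff_le_norm:
  fixes h :: "'a::euclidean_space"
  assumes t: "0 < t"
  shows "(\<integral>\<^sup>+z. ennreal \<bar>gauss_kernel t (z - h) - gauss_kernel t z\<bar> \<partial>lborel) \<le> ennreal (3 * (norm h / t))"
proof (cases "h = 0")
  case False
  define l where "l = t / norm h"
  define e where "e = exp (- pi * (norm h / t)\<^sup>2 / 4)"
  have l: "l > 0" using False t by (simp add: l_def)
  define G where "G z = gauss_kernel t z" for z :: 'a
  have [measurable]: "G \<in> borel_measurable borel" unfolding G_def by measurable
  have G0: "0 \<le> G z" for z unfolding G_def by (rule gauss_kernel_nonneg[OF t])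
  have G1: "integrable lborel (\<lambda>z. G (z - c))" "(LINT z|lborel. G (z - c)) = 1" for c
  proof -
    have i: "integrable lborel G" unfolding G_def by (rule gauss_kernel_integral[OF t])
    then show i': "integrable lborel (\<lambda>z. G (z - c))"
      using integrable_lborel_affine[OF i, of 1 "- c"] by simp
    have "(\<integral>\<^sup>+z. ennreal (G (z - c)) \<partial>lborel) = 1"
      using nn_integral_lborel_translation[of "\<lambda>z. ennreal (G z)" c] gauss_kernel_integral(2)[OF t, where 'a='a] by (simp add: G_def)
    then show "(LINT z|lborel. G (z - c)) = 1"
      using nn_integral_eq_integral[OF i'] G0 by (simp add: G0 integral_nonneg_AE)
  qed
  \<comment> \<open>The lower bound serves the integral 2 - 2e of (a - b)^2, the upper bound the
    integral 2 + 2e of (a + b)^2.\<close>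
  have e: "1 - pi / 4 * (norm h / t)\<^sup>2 \<le> e" "e \<le> 1"
    using exp_ge_add_one_self[of "- pi * (norm h / t)\<^sup>2 / 4"] by (auto simp: e_def)
  \<comment> \<open>Writing \<open>G (z - 0)\<close> gives all three terms the shape of
    \<open>G1\<close>.\<close>
  define R where "R z = l / 2 * (G (z - h) + G (z - 0) - 2 * e * G (z - h /\<^sub>R 2))
     + 1 / (2 * l) * (G (z - h) + G (z - 0) + 2 * e * G (z - h /\<^sub>R 2))" for z
  have R_ge: "\<bar>G (z - h) - G z\<bar> \<le> R z" for z
  proof -
    define a where "a = sqrt (G (z - h))"
    define b where "b = sqrt (G z)"
    have ab: "a\<^sup>2 = G (z - h)" "b\<^sup>2 = G z" "a * b = e * G (z - h /\<^sub>R 2)" "0 \<le> a" "0 \<le> b"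
      using gauss_kernel_half_product[OF t, of z h] G0 by (auto simp: a_def b_def G_def e_def)
    have "G (z - h) - G z = (a - b) * (a + b)"
      unfolding ab(1,2)[symmetric] by (simp add: power2_eq_square algebra_simps)
    then have "\<bar>G (z - h) - G z\<bar> = \<bar>a - b\<bar> * \<bar>a + b\<bar>" by (simp only: abs_mult)
    also have "\<dots> \<le> l / 2 * \<bar>a - b\<bar>\<^sup>2 + 1 / (2 * l) * \<bar>a + b\<bar>\<^sup>2"
      using zero_le_power2[of "l * \<bar>a - b\<bar> - \<bar>a + b\<bar>"] l
      by (simp add: field_simps power2_eq_square del: abs_mult_self_eq)
    also have "\<dots> = l / 2 * (a\<^sup>2 + b\<^sup>2 - 2 * (a * b)) + 1 / (2 * l) * (a\<^sup>2 + b\<^sup>2 + 2 * (a * b))"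
      by (simp add: power2_diff power2_sum algebra_simps)
    also have "\<dots> = R z"
      unfolding ab R_def by (simp add: mult.assoc)
    finally show ?thesis .
  qed
  have "has_bochner_integral lborel R (l / 2 * (1 + 1 - 2 * e * 1) + 1 / (2 * l) * (1 + 1 + 2 * e * 1))" unfolding R_def
    by (intro has_bochner_integral_add has_bochner_integral_diff has_bochner_integral_mult_right)
       (simp_all only: has_bochner_integral_iff G1 simp_thms)
  then have R_int: "integrable lborel R" and R_eq: "integral\<^sup>L lborel R = l / 2 * (2 - 2 * e) + 1 / (2 * l) * (2 + 2 * e)"
    by (simp_all add: has_bochner_integral_iff)
  note R_eq
  \<comment> \<open>With \<open>l = t / norm h\<close> the two terms become \<open>pi / 4\<close>
    and 2 times \<open>norm h / t\<close>. Their sum is below 3 times that ratio because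
    \<open>pi < 4\<close>; this is where the constant 3 comes from.\<close>
  also have "\<dots> \<le> l / 2 * (2 * (pi / 4 * (norm h / t)\<^sup>2)) + 1 / (2 * l) * (2 + 2 * 1)"
    using l e by (intro add_mono mult_left_mono) auto
  also have "\<dots> = (pi / 4 + 2) * (norm h / t)"
    using t False by (simp add: l_def power2_eq_square field_simps)
  also have "\<dots> \<le> 3 * (norm h / t)"
    using pi_less_4 t by (intro mult_right_mono) auto
  finally have R_le: "integral\<^sup>L lborel R \<le> 3 * (norm h / t)" .
  have "(\<integral>\<^sup>+z. ennreal \<bar>G (z - h) - G z\<bar> \<partial>lborel) \<le> (\<integral>\<^sup>+z. ennreal (R z) \<partial>lborel)"
    by (intro nn_integral_mono ennreal_leI R_ge)
  also have "\<dots> = ennreal (integral\<^sup>L lborel R)"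
    by (intro nn_integral_eq_integral R_int AE_I2 order_trans[OF abs_ge_zero R_ge])
  also have "\<dots> \<le> ennreal (3 * (norm h / t))" by (intro ennreal_leI R_le)
  finally show ?thesis unfolding G_def .
qed simp

text \<open>Split at t = a. Below, \<open>t powr (s - 1)\<close> is integrable because s > 0; above,
  the minimum turns it into \<open>a * t powr (s - 2)\<close>, which is integrable because s < 1.
  The pieces give 1 / s and 1 / (1 - s).\<close>

lemma nn_integral_powr_min_le:
  assumes s: "0 < s" "s < 1" and a: "0 < a"
  shows "(\<integral>\<^sup>+t. ennreal (min 1 (a / t) * t powr (s - 1)) * indicator {0<..} t \<partial>lborel)
    \<le> ennreal ((1 / s + 1 / (1 - s)) * a powr s)"
proof -
  have 1: "(\<integral>\<^sup>+t. ennreal (t powr (s - 1)) * indicator {0..a} t \<partial>lborel) = ennreal (a powr s / s)"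
    using nn_integral_has_integral_lebesgue'[OF _ has_integral_powr_from_0[of "s - 1" a]] s a by simp
  have 2: "(\<integral>\<^sup>+t. ennreal (t powr (s - 2)) * indicator {a..} t \<partial>lborel) = ennreal (a powr (s - 1) / (1 - s))"
    using nn_integral_has_integral_lebesgue'[OF _ has_integral_powr_to_inf[of "s - 2" a]] s a
      minus_divide_right[of "a powr (s - 1)" "s - 1"] by simp
  have "(\<integral>\<^sup>+t. ennreal (min 1 (a / t) * t powr (s - 1)) * indicator {0<..} t \<partial>lborel)
    \<le> (\<integral>\<^sup>+t. ennreal (t powr (s - 1)) * indicator {0..a} t
        + ennreal a * (ennreal (t powr (s - 2)) * indicator {a..} t) \<partial>lborel)"
  proof (intro nn_integral_mono)
    fix t :: real
    consider "t \<le> 0" | "0 < t" "t \<le> a" | "a < t" by linarith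
    then show "ennreal (min 1 (a / t) * t powr (s - 1)) * indicator {0<..} t
      \<le> ennreal (t powr (s - 1)) * indicator {0..a} t + ennreal a * (ennreal (t powr (s - 2)) * indicator {a..} t)"
    proof cases
      case 2
      then have "min 1 (a / t) = 1" by (simp add: field_simps)
      with 2 show ?thesis by (simp add: add_increasing2)
    next
      case 3
      have "t powr (s - 1) = t * t powr (s - 2)"
        using powr_mult_base[of t "s - 2"] 3 a by simp
      moreover have "min 1 (a / t) = a / t" using 3 a by (simp add: field_simps)
      ultimately show ?thesis using 3 a by (simp add: ennreal_mult'[symmetric])
    qed simp
  qed
  also have "\<dots> = ennreal (a powr s / s) + ennreal a * ennreal (a powr (s - 1) / (1 - s))"
    by (subst nn_integral_add) (simp_all add: nn_integral_cmult 1 2)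
  also have "\<dots> = ennreal (a powr s / s + a * (a powr (s - 1) / (1 - s)))"
    using s a by (simp add: ennreal_mult'[symmetric] ennreal_plus[symmetric] del: ennreal_plus)
  also have "a powr s / s + a * (a powr (s - 1) / (1 - s)) = (1 / s + 1 / (1 - s)) * a powr s"
    using powr_mult_base[of a "s - 1"] a by (simp add: distrib_right)
  finally show ?thesis .
qed

lemma nn_integral_gauss_kernel_diff_powr_le:
  fixes h :: "'a::euclidean_space"
  assumes s: "0 < s" "s < 1"
  shows "(\<integral>\<^sup>+t. (\<integral>\<^sup>+z. ennreal \<bar>gauss_kernel t (z - h) - gauss_kernel t z\<bar> \<partial>lborel) * ennreal (t powr (s - 1)) * indicator {0<..} t \<partial>lborel)
    \<le> ennreal (3 * (1 / s + 1 / (1 - s)) * norm h powr s)"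
proof (cases "h = 0")
  case False
  have "(\<integral>\<^sup>+t. (\<integral>\<^sup>+z. ennreal \<bar>gauss_kernel t (z - h) - gauss_kernel t z\<bar> \<partial>lborel) * ennreal (t powr (s - 1)) * indicator {0<..} t \<partial>lborel)
    \<le> (\<integral>\<^sup>+t. ennreal 3 * (ennreal (min 1 (norm h / t) * t powr (s - 1)) * indicator {0<..} t) \<partial>lborel)"
  proof (intro nn_integral_mono)
    fix t :: real
    show "(\<integral>\<^sup>+z. ennreal \<bar>gauss_kernel t (z - h) - gauss_kernel t z\<bar> \<partial>lborel) * ennreal (t powr (s - 1)) * indicator {0<..} t
      \<le> ennreal 3 * (ennreal (min 1 (norm h / t) * t powr (s - 1)) * indicator {0<..} t)"
    proof (cases "0 < t")
      case t: True
      let ?I = "\<integral>\<^sup>+z. ennreal \<bar>gauss_kernel t (z - h) - gauss_kernel t z\<bar> \<partial>lborel"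
      \<comment> \<open>The bound 2 is relaxed to 3 so that it combines with the other bound into
        three times one minimum.\<close>
      have "?I \<le> ennreal 3"
        by (rule order_trans[OF nn_integral_gauss_kernel_diff_le_2[OF t]]) simp
      with nn_integral_gauss_kernel_diff_le_norm[OF t, of h]
      have "?I \<le> ennreal (3 * min 1 (norm h / t))" by (simp add: min_def)
      then have "?I * ennreal (t powr (s - 1)) \<le> ennreal (3 * min 1 (norm h / t)) * ennreal (t powr (s - 1))"
        by (rule mult_right_mono) simp
      also have "\<dots> = ennreal 3 * ennreal (min 1 (norm h / t) * t powr (s - 1))"
        using t by (subst (1 2) ennreal_mult[symmetric]) (simp_all add: mult.assoc)
      finally show ?thesis using t by simp
    qed simp
  qed
  also have "\<dots> = ennreal 3 * (\<integral>\<^sup>+t. ennreal (min 1 (norm h / t) * t powr (s - 1)) * indicator {0<..} t \<partial>lborel)"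
    by (rule nn_integral_cmult) measurable
  also have "\<dots> \<le> ennreal 3 * ennreal ((1 / s + 1 / (1 - s)) * norm h powr s)"
    using False by (intro mult_left_mono nn_integral_powr_min_le s) auto
  also have "\<dots> = ennreal (3 * (1 / s + 1 / (1 - s)) * norm h powr s)"
    unfolding mult.assoc by (rule ennreal_mult[symmetric]) (use s in simp_all)
  finally show ?thesis .
qed simp

text \<open>The constant is \<open>Gamma (s / 2) / (2 * pi powr (s / 2))\<close>, but only that it
  is finite and positive matters. The power of a follows from the substitution of
  \<open>a * t\<close> for t in the integral of \<open>k\<close>.\<close>

lemma gaussian_subordination:
  assumes s: "0 < s" "s < 1"
  obtains c where "0 < c" "\<And>a. 0 < a \<Longrightarrow>
    has_bochner_integral lborel (\<lambda>t. indicator {0<..} t * (exp (- pi * (t * a)\<^sup>2) * t powr (s - 1))) (c * a powr (- s))"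
proof -
  define k where "k t = indicator {0<..} t * (exp (- pi * t\<^sup>2) * t powr (s - 1))" for t :: real
  have [measurable]: "k \<in> borel_measurable borel" unfolding k_def by measurable
  have k0: "0 \<le> k t" for t by (simp add: k_def)
  have "(\<integral>\<^sup>+t. ennreal (k t) \<partial>lborel) \<le> (\<integral>\<^sup>+t. ennreal (min 1 (1 / t) * t powr (s - 1)) * indicator {0<..} t \<partial>lborel)"
  proof (intro nn_integral_mono)
    fix t :: real
    \<comment> \<open>This majorant reduces finiteness to \<open>nn_integral_powr_min_le\<close>
      with a = 1.\<close>
    have "exp (- pi * t\<^sup>2) \<le> min 1 (1 / t)" if t: "0 < t"
    proof -
      have "1 + pi * t\<^sup>2 \<le> exp (pi * t\<^sup>2)" by simp
      moreover have "t \<le> 1 + pi * t\<^sup>2"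
      proof -
        have "t \<le> 1 + 1 * t\<^sup>2"
          using zero_le_power2[of "t - 1 / 2"] unfolding power2_diff by (simp add: power2_eq_square)
        also have "\<dots> \<le> 1 + pi * t\<^sup>2"
          using pi_gt3 by (intro add_left_mono mult_right_mono) auto
        finally show ?thesis .
      qed
      ultimately have "t \<le> exp (pi * t\<^sup>2)" by linarith
      then show ?thesis using t by (simp add: exp_minus field_simps)
    qed
    then show "ennreal (k t) \<le> ennreal (min 1 (1 / t) * t powr (s - 1)) * indicator {0<..} t"
      by (auto simp: k_def indicator_def intro!: ennreal_leI mult_right_mono)
  qed
  also have "\<dots> < \<infinity>"
    using nn_integral_powr_min_le[OF s, of 1] by (auto simp: le_less_trans)
  finally have k_int: "integrable lborel k"
    by (intro integrableI_bounded) (simp_all add: k0)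
  define c where "c = integral\<^sup>L lborel k"
  \<comment> \<open>Positivity of the constant: a zero integral would force \<open>k\<close> to
    vanish almost everywhere, but \<open>k\<close> is positive on (0, 1).\<close>
  have "c \<noteq> 0"
  proof
    assume "c = 0"
    then have "AE t in lborel. k t = 0"
      using integral_nonneg_eq_0_iff_AE[OF k_int] k0 by (simp add: c_def)
    then have "AE t in lborel. t \<notin> {0<..<1::real}"
      by eventually_elim (auto simp: k_def)
    then have "{0<..<1::real} \<in> null_sets lborel" by (simp add: AE_iff_null_sets)
    then have "emeasure lborel {0<..<1::real} = 0" by (rule null_setsD1)
    then show False by simp
  qed
  then have c: "0 < c" using integral_nonneg_AE[of k lborel] k0 by (simp add: c_def order_less_le)
  have "has_bochner_integral lborel (\<lambda>t. indicator {0<..} t * (exp (- pi * (t * a)\<^sup>2) * t powr (s - 1))) (c * a powr (- s))"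
    if a: "0 < a" for a
  proof -
    have "has_bochner_integral lborel k c"
      using k_int by (simp add: has_bochner_integral_iff c_def)
    then have "has_bochner_integral lborel (\<lambda>t. k (0 + a * t)) (c /\<^sub>R \<bar>a\<bar>)"
      using a lborel_has_bochner_integral_real_affine_iff[of a k c 0] by simp
    then have "has_bochner_integral lborel (\<lambda>t. a powr (1 - s) * k (0 + a * t)) (a powr (1 - s) * (c /\<^sub>R \<bar>a\<bar>))"
      by (intro has_bochner_integral_mult_right)
    moreover have "a powr (1 - s) * (c /\<^sub>R \<bar>a\<bar>) = c * a powr (- s)"
      using a powr_diff[of a 1 s] by (simp add: powr_minus field_simps)
    moreover have "a powr (1 - s) * k (0 + a * t) = indicator {0<..} t * (exp (- pi * (t * a)\<^sup>2) * t powr (s - 1))" for t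
    proof (cases "0 < t")
      case True
      have "a powr (1 - s) * (a * t) powr (s - 1) = t powr (s - 1)"
        using a True by (simp add: powr_mult mult.assoc[symmetric] powr_add[symmetric])
      then show ?thesis using a True by (simp add: k_def mult_ac)
    qed (use a in \<open>auto simp: k_def zero_less_mult_iff\<close>)
    ultimately show ?thesis by (simp only:)
  qed
  with c show ?thesis using that by blast
qed

subsection \<open>Fourier multipliers as convolutions\<close>

text \<open>Inserting the transform of g and exchanging the integrals, with majorant |m(\<xi>)|
  |g(y)|, leaves the kernel at x - y. Integrability of m makes the kernel bounded, so its product
  with a reflected translate of g is integrable.\<close>

lemma fourier_multiplier_eq_convolution:
  fixes m g :: "'a::euclidean_space \<Rightarrow> complex"
  assumes m: "integrable lborel m" and g: "integrable lborel g"
  shows "integrable lborel (\<lambda>h. inverse_fourier m h * g (x - h))"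
    and "fourier_multiplier m g x = (LINT h|lborel. inverse_fourier m h * g (x - h))"
proof -
  have [measurable]: "m \<in> borel_measurable borel" "g \<in> borel_measurable borel"
    using m g by (auto dest: borel_measurable_integrable)
  have [measurable]: "inverse_fourier m \<in> borel_measurable borel"
    by (rule borel_measurable_inverse_fourier) measurable
  show "integrable lborel (\<lambda>h. inverse_fourier m h * g (x - h))"
  proof (rule Bochner_Integration.integrable_bound)
    have "integrable lborel (\<lambda>h. g (x - h))"
      using integrable_lborel_affine[OF g, of "-1" x] by simp
    then show "integrable lborel (\<lambda>h. (LINT x|lborel. norm (m x)) * norm (g (x - h)))"
      by (intro integrable_mult_right integrable_norm)
    show "AE h in lborel. norm (inverse_fourier m h * g (x - h)) \<le> norm ((LINT x|lborel. norm (m x)) * norm (g (x - h)))"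
      by (intro AE_I2) (simp add: norm_mult inverse_fourier_eq_fourier mult_right_mono norm_fourier_le
          order_trans[OF norm_fourier_le abs_ge_self])
  qed measurable
  have "fourier_multiplier m g x = (LINT \<xi>|lborel. LINT y|lborel. m \<xi> * (g y * phase (- (y \<bullet> \<xi>))) * phase (x \<bullet> \<xi>))"
    unfolding fourier_multiplier_def inverse_fourier_phase fourier_phase
    by (simp only: integral_mult_left_zero integral_mult_right_zero)
  also have "\<dots> = (LINT y|lborel. LINT \<xi>|lborel. m \<xi> * (g y * phase (- (y \<bullet> \<xi>))) * phase (x \<bullet> \<xi>))"
    by (rule integral_swap_dominated[OF integrable_norm[OF m] integrable_norm[OF g]])
       (simp_all add: norm_mult)
  also have "\<dots> = (LINT y|lborel. inverse_fourier m (x - y) * g y)"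
    unfolding inverse_fourier_phase integral_mult_left_zero[symmetric]
    by (intro Bochner_Integration.integral_cong refl) (simp add: inner_diff_left phase_diff mult_ac)
  also have "\<dots> = (LINT h|lborel. inverse_fourier m h * g (x - h))"
    by (subst integral_lborel_affine[of "-1" _ x]) simp_all
  finally show "fourier_multiplier m g x = (LINT h|lborel. inverse_fourier m h * g (x - h))" .
qed

text \<open>The power lies below \<open>1 + norm \<xi>\<close>, so the cases 0 and 1 of
  \<open>fourier_schwartz_integrable\<close> suffice. It follows that the inversion integral
  defining \<open>|D|^s f\<close> converges absolutely.\<close>

lemma abs_D_powr_integrand_integrable:
  fixes f :: "'a::euclidean_space \<Rightarrow> complex"
  assumes f: "schwartz f" and s: "0 \<le> s" "s \<le> 1"
  shows "integrable lborel (\<lambda>\<xi>. complex_of_real (norm \<xi> powr s) * fourier f \<xi>)"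
proof (rule Bochner_Integration.integrable_bound)
  note [measurable] = fourier_borel_measurable[OF schwartz_measurable[OF f]]
  show "integrable lborel (\<lambda>\<xi>. norm (fourier f \<xi>) + norm \<xi> * norm (fourier f \<xi>))"
    using fourier_schwartz_integrable[OF f, of 0] fourier_schwartz_integrable[OF f, of 1] by simp
  show "(\<lambda>\<xi>. complex_of_real (norm \<xi> powr s) * fourier f \<xi>) \<in> borel_measurable lborel" by measurable
  show "AE \<xi> in lborel. norm (complex_of_real (norm \<xi> powr s) * fourier f \<xi>)
    \<le> norm (norm (fourier f \<xi>) + norm \<xi> * norm (fourier f \<xi>))"
  proof (rule AE_I2)
    fix \<xi> :: 'a
    have "norm \<xi> powr s \<le> 1 + norm \<xi>"
    proof (cases "norm \<xi> \<le> 1")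
      case True
      then have "norm \<xi> powr s \<le> 1" using s by (intro powr_le1) auto
      then show ?thesis by (simp add: add_increasing2)
    next
      case False
      then have "norm \<xi> powr s \<le> norm \<xi> powr 1" using s by (intro powr_mono) auto
      then show ?thesis using False by simp
    qed
    then have "norm \<xi> powr s * norm (fourier f \<xi>) \<le> (1 + norm \<xi>) * norm (fourier f \<xi>)"
      by (intro mult_right_mono) auto
    then show "norm (complex_of_real (norm \<xi> powr s) * fourier f \<xi>) \<le> norm (norm (fourier f \<xi>) + norm \<xi> * norm (fourier f \<xi>))"
      by (simp add: norm_mult distrib_right)
  qed
qed

text \<open>Damping by a Gaussian in frequency is averaging by a heat kernel in space. With
  \<open>m\<close> the integrand of \<open>|D|^s f\<close>, it identifies the part of the
  subordination formula at a fixed t.\<close>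

lemma inverse_fourier_convolution_gauss_kernel:
  fixes m :: "'a::euclidean_space \<Rightarrow> complex"
  assumes m: "integrable lborel m" and t: "0 < t"
  shows "integrable lborel (\<lambda>z. complex_of_real (gauss_kernel t z) * inverse_fourier m (x - z))"
    and "(LINT z|lborel. complex_of_real (gauss_kernel t z) * inverse_fourier m (x - z))
      = (LINT \<xi>|lborel. complex_of_real (exp (- pi * (t * norm \<xi>)\<^sup>2)) * m \<xi> * phase (x \<bullet> \<xi>))"
proof -
  have [measurable]: "m \<in> borel_measurable borel"
    using m by (auto dest: borel_measurable_integrable)
  have [measurable]: "inverse_fourier m \<in> borel_measurable borel"
    by (rule borel_measurable_inverse_fourier) measurable
  have G: "integrable lborel (gauss_kernel t :: 'a \<Rightarrow> real)" by (rule gauss_kernel_integral[OF t])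
  show "integrable lborel (\<lambda>z. complex_of_real (gauss_kernel t z) * inverse_fourier m (x - z))"
  proof (rule Bochner_Integration.integrable_bound)
    show "integrable lborel (\<lambda>z::'a. gauss_kernel t z * (LINT x|lborel. norm (m x)))"
      by (intro integrable_mult_left G)
    show "AE z in lborel. norm (complex_of_real (gauss_kernel t z) * inverse_fourier m (x - z))
      \<le> norm (gauss_kernel t z * (LINT x|lborel. norm (m x)))"
      by (intro AE_I2) (simp add: norm_mult abs_mult inverse_fourier_eq_fourier mult_left_mono norm_fourier_le)
  qed measurable
  have "(LINT z|lborel. complex_of_real (gauss_kernel t z) * inverse_fourier m (x - z))
    = (LINT z|lborel. LINT \<xi>|lborel. complex_of_real (gauss_kernel t z) * (m \<xi> * phase ((x - z) \<bullet> \<xi>)))"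
    unfolding inverse_fourier_phase by simp
  also have "\<dots> = (LINT \<xi>|lborel. LINT z|lborel. complex_of_real (gauss_kernel t z) * (m \<xi> * phase ((x - z) \<bullet> \<xi>)))"
    by (rule integral_swap_dominated[OF G integrable_norm[OF m]])
       (simp_all add: norm_mult gauss_kernel_nonneg[OF t])
  also have "\<dots> = (LINT \<xi>|lborel. (LINT z|lborel. complex_of_real (gauss_kernel t z) * phase (z \<bullet> (- \<xi>))) * (m \<xi> * phase (x \<bullet> \<xi>)))"
    unfolding integral_mult_left_zero[symmetric]
    by (intro Bochner_Integration.integral_cong refl) (simp add: inner_diff_left phase_diff mult_ac)
  also have "\<dots> = (LINT \<xi>|lborel. complex_of_real (exp (- pi * (t * norm \<xi>)\<^sup>2)) * m \<xi> * phase (x \<bullet> \<xi>))"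
    unfolding fourier_gauss_kernel(2)[OF t] by (simp add: mult.assoc)
  finally show "(LINT z|lborel. complex_of_real (gauss_kernel t z) * inverse_fourier m (x - z))
      = (LINT \<xi>|lborel. complex_of_real (exp (- pi * (t * norm \<xi>)\<^sup>2)) * m \<xi> * phase (x \<bullet> \<xi>))" .
qed

text \<open>No integrability is assumed: the Bochner integral of a non-integrable function is 0 by
  convention.\<close>

lemma norm_lebesgue_integral_le_nn_integral:
  fixes f :: "'a \<Rightarrow> 'b::{banach, second_countable_topology}"
  shows "ennreal (norm (integral\<^sup>L M f)) \<le> (\<integral>\<^sup>+x. ennreal (norm (f x)) \<partial>M)"
  by (cases "integrable M f") (auto simp: integral_norm_bound_ennreal not_integrable_integral_eq)

text \<open>Subordination replaces \<open>|\<xi>|\<^sup>-\<^sup>s\<close> by an average of Gaussians, so that \<open>f\<close> is recovered from \<open>|D|\<^sup>s f\<close>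
  by averaging heat flows.\<close>

lemma schwartz_translation_diff_le:
  fixes f :: "'a::euclidean_space \<Rightarrow> complex"
  assumes f: "schwartz f" and s: "0 < s" "s < 1" and c0: "0 < c"
    and c: "\<And>a. 0 < a \<Longrightarrow>
      has_bochner_integral lborel (\<lambda>t. indicator {0<..} t * (exp (- pi * (t * a)\<^sup>2) * t powr (s - 1))) (c * a powr (- s))"
  shows "ennreal (c * norm (f (x - h) - f x)) \<le>
    (\<integral>\<^sup>+t. (\<integral>\<^sup>+z. ennreal \<bar>gauss_kernel t (z - h) - gauss_kernel t z\<bar> * ennreal (norm (abs_D_powr s f (x - z))) \<partial>lborel)
       * ennreal (t powr (s - 1)) * indicator {0<..} t \<partial>lborel)"
proof -
  define m where "m \<xi> = complex_of_real (norm \<xi> powr s) * fourier f \<xi>" for \<xi>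
  have m_int: "integrable lborel m"
    unfolding m_def using s by (intro abs_D_powr_integrand_integrable f) auto
  have F: "abs_D_powr s f = inverse_fourier m"
    by (simp add: abs_D_powr_def fourier_multiplier_def m_def[abs_def])
  note [measurable] = fourier_borel_measurable[OF schwartz_measurable[OF f]]
  have [measurable]: "m \<in> borel_measurable borel" unfolding m_def[abs_def] by measurable
  define p where "p \<xi> = phase ((x - h) \<bullet> \<xi>) - phase (x \<bullet> \<xi>)" for \<xi>
  have [measurable]: "p \<in> borel_measurable borel" unfolding p_def[abs_def] by measurable
  have p_le: "norm (p \<xi>) \<le> 2" for \<xi>
    unfolding p_def by (rule order_trans[OF norm_triangle_ineq4]) simp
  define k where "k t \<xi> = indicator {0<..} t * (exp (- pi * (t * norm \<xi>)\<^sup>2) * t powr (s - 1))" for t and \<xi> :: 'a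
  have k_meas [measurable]: "(\<lambda>(\<xi>, t). k t \<xi>) \<in> borel_measurable (lborel \<Otimes>\<^sub>M lborel)"
    unfolding k_def by measurable
  have k0: "0 \<le> k t \<xi>" for t \<xi> by (simp add: k_def)
  \<comment> \<open>At \<xi> = 0 subordination breaks down, since the integral of
    \<open>k t 0\<close> over t diverges. The origin is a null set.\<close>
  have nz: "AE \<xi> in lborel. \<xi> \<noteq> (0 :: 'a)" by (rule AE_lborel_singleton)
  have k_int: "integrable lborel (\<lambda>t. k t \<xi>)" "(LINT t|lborel. k t \<xi>) = c * norm \<xi> powr (- s)" if "\<xi> \<noteq> 0" for \<xi>
    using c[of "norm \<xi>"] that by (simp_all add: k_def has_bochner_integral_iff)
  have km: "norm \<xi> powr (- s) * norm (m \<xi>) = norm (fourier f \<xi>)" if "\<xi> \<noteq> 0" for \<xi>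
    using that by (simp add: m_def norm_mult mult.assoc[symmetric] powr_add[symmetric])
  \<comment> \<open>Integrating the modulus over t yields a factor |\<xi>|^(-s) that cancels the
    |\<xi>|^s inside \<open>m\<close>. What remains is a multiple of the integrable transform of f
    times the bounded \<open>p\<close>.\<close>
  have int: "integrable (lborel \<Otimes>\<^sub>M lborel) (\<lambda>(\<xi>, t). complex_of_real (k t \<xi>) * (m \<xi> * p \<xi>))"
  proof (rule lborel_pair.Fubini_integrable)
    have eq: "(LINT t|lborel. norm (complex_of_real (k t \<xi>) * (m \<xi> * p \<xi>))) = c * norm (fourier f \<xi>) * norm (p \<xi>)" if "\<xi> \<noteq> 0" for \<xi>
    proof -
      have "(LINT t|lborel. norm (complex_of_real (k t \<xi>) * (m \<xi> * p \<xi>))) = (LINT t|lborel. k t \<xi> * (norm (m \<xi>) * norm (p \<xi>)))"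
        using k0 by (simp add: norm_mult)
      also have "\<dots> = c * (norm \<xi> powr (- s) * norm (m \<xi>)) * norm (p \<xi>)"
        by (simp add: k_int[OF that])
      finally show ?thesis unfolding km[OF that] .
    qed
    have "integrable lborel (\<lambda>\<xi>. c * norm (fourier f \<xi>) * norm (p \<xi>))"
    proof (rule Bochner_Integration.integrable_bound)
      show "integrable lborel (\<lambda>\<xi>. c * norm (fourier f \<xi>) * 2)"
        using fourier_schwartz_integrable[OF f, of 0] by (intro integrable_mult_left integrable_mult_right) simp
      show "AE \<xi> in lborel. norm (c * norm (fourier f \<xi>) * norm (p \<xi>)) \<le> norm (c * norm (fourier f \<xi>) * 2)"
        using c0 p_le by (intro AE_I2) (simp add: abs_mult mult_left_mono)
    qed measurable
    then show "integrable lborel (\<lambda>\<xi>. LINT t|lborel. norm (case (\<xi>, t) of (\<xi>, t) \<Rightarrow> complex_of_real (k t \<xi>) * (m \<xi> * p \<xi>)))"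
      by (rule integrable_cong_AE_imp) (use nz in \<open>auto simp: eq elim!: eventually_mono\<close>)
    show "AE \<xi> in lborel. integrable lborel (\<lambda>t. case (\<xi>, t) of (\<xi>, t) \<Rightarrow> complex_of_real (k t \<xi>) * (m \<xi> * p \<xi>))"
      using nz by eventually_elim (auto intro!: integrable_mult_left k_int(1))
  qed measurable
  \<comment> \<open>By inversion the increment of f is the integral of its transform against
    \<open>p\<close>; the t-integral is then inserted in place of the factor c.\<close>
  have "c *\<^sub>R (f (x - h) - f x) = (LINT \<xi>|lborel. c * (fourier f \<xi> * p \<xi>))"
  proof -
    have fint: "integrable lborel (fourier f)"
      using fourier_schwartz_integrable[OF f, of 0] by (simp add: integrable_norm_iff)
    have "f (x - h) - f x = inverse_fourier (fourier f) (x - h) - inverse_fourier (fourier f) x"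
      by (simp add: schwartz_fourier_inversion[OF f])
    also have "\<dots> = (LINT \<xi>|lborel. fourier f \<xi> * p \<xi>)"
      unfolding inverse_fourier_phase p_def right_diff_distrib
      by (rule Bochner_Integration.integral_diff[symmetric]) (intro integrable_mult_phase fint, measurable)+
    finally show ?thesis by (simp add: scaleR_conv_of_real)
  qed
  also have "\<dots> = (LINT \<xi>|lborel. LINT t|lborel. complex_of_real (k t \<xi>) * (m \<xi> * p \<xi>))"
  proof (rule integral_cong_AE)
    show "AE \<xi> in lborel. c * (fourier f \<xi> * p \<xi>) = (LINT t|lborel. complex_of_real (k t \<xi>) * (m \<xi> * p \<xi>))"
      using nz
    proof eventually_elim
      fix \<xi> :: 'a assume \<xi>: "\<xi> \<noteq> 0"
      have "(LINT t|lborel. complex_of_real (k t \<xi>) * (m \<xi> * p \<xi>))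
          = complex_of_real (LINT t|lborel. k t \<xi>) * (m \<xi> * p \<xi>)"
        by (simp add: integral_complex_of_real)
      also have "\<dots> = c * (complex_of_real (norm \<xi> powr (- s) * norm \<xi> powr s) * fourier f \<xi> * p \<xi>)"
        unfolding k_int(2)[OF \<xi>] m_def by (simp add: mult_ac)
      also have "norm \<xi> powr (- s) * norm \<xi> powr s = 1"
        using \<xi> by (simp flip: powr_add)
      finally show "c * (fourier f \<xi> * p \<xi>) = (LINT t|lborel. complex_of_real (k t \<xi>) * (m \<xi> * p \<xi>))"
        by (simp only: of_real_1 mult_1_left)
    qed
  qed measurable
  also have "\<dots> = (LINT t|lborel. LINT \<xi>|lborel. complex_of_real (k t \<xi>) * (m \<xi> * p \<xi>))"
    using lborel_pair.Fubini_integral[OF int] by simp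
  finally have "ennreal (norm (c *\<^sub>R (f (x - h) - f x)))
    \<le> (\<integral>\<^sup>+t. ennreal (norm (LINT \<xi>|lborel. complex_of_real (k t \<xi>) * (m \<xi> * p \<xi>))) \<partial>lborel)"
    by (simp only: norm_lebesgue_integral_le_nn_integral)
  also have "\<dots> \<le> (\<integral>\<^sup>+t. (\<integral>\<^sup>+z. ennreal \<bar>gauss_kernel t (z - h) - gauss_kernel t z\<bar> * ennreal (norm (abs_D_powr s f (x - z))) \<partial>lborel)
       * ennreal (t powr (s - 1)) * indicator {0<..} t \<partial>lborel)"
  proof (intro nn_integral_mono)
    fix t :: real
    show "ennreal (norm (LINT \<xi>|lborel. complex_of_real (k t \<xi>) * (m \<xi> * p \<xi>))) \<le>
      (\<integral>\<^sup>+z. ennreal \<bar>gauss_kernel t (z - h) - gauss_kernel t z\<bar> * ennreal (norm (abs_D_powr s f (x - z))) \<partial>lborel)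
       * ennreal (t powr (s - 1)) * indicator {0<..} t"
    proof (cases "0 < t")
      case t: True
      define e where "e \<xi> = complex_of_real (exp (- pi * (t * norm \<xi>)\<^sup>2))" for \<xi> :: 'a
      have [measurable]: "e \<in> borel_measurable borel" unfolding e_def[abs_def] by measurable
      have em: "integrable lborel (\<lambda>\<xi>. e \<xi> * m \<xi>)"
        by (rule Bochner_Integration.integrable_bound[OF m_int])
           (auto simp: e_def norm_mult intro!: AE_I2 mult_left_le_one_le)
      define G where "G y z = complex_of_real (gauss_kernel t z) * abs_D_powr s f (y - z)" for y z
      have G: "integrable lborel (G y)" "integral\<^sup>L lborel (G y) = (LINT \<xi>|lborel. e \<xi> * m \<xi> * phase (y \<bullet> \<xi>))" for y
        using inverse_fourier_convolution_gauss_kernel[OF m_int t] unfolding G_def F e_def by auto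
      \<comment> \<open>Shifting z by h makes both heat averages, at x - h and at x, act on the same
        values of \<open>|D|^s f\<close> at x - z, so their difference falls on the kernels
        alone.\<close>
      have G': "integrable lborel (\<lambda>z. G (x - h) (z - h))"
        "integral\<^sup>L lborel (G (x - h)) = integral\<^sup>L lborel (\<lambda>z. G (x - h) (z - h))"
        using integrable_lborel_affine[OF G(1)[of "x - h"], of 1 "- h"]
          integral_lborel_affine[of 1 "G (x - h)" "- h"] by simp_all
      have "(LINT \<xi>|lborel. complex_of_real (k t \<xi>) * (m \<xi> * p \<xi>))
          = (LINT \<xi>|lborel. complex_of_real (t powr (s - 1)) * (e \<xi> * m \<xi> * phase ((x - h) \<bullet> \<xi>) - e \<xi> * m \<xi> * phase (x \<bullet> \<xi>)))"
        using t by (intro Bochner_Integration.integral_cong refl) (simp add: k_def e_def p_def algebra_simps)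
      also have "\<dots> = t powr (s - 1) * (integral\<^sup>L lborel (G (x - h)) - integral\<^sup>L lborel (G x))"
        unfolding G(2) by (simp add: em integrable_mult_phase)
      also have "integral\<^sup>L lborel (G (x - h)) - integral\<^sup>L lborel (G x) = (LINT z|lborel. G (x - h) (z - h) - G x z)"
        unfolding G'(2) by (rule Bochner_Integration.integral_diff[symmetric] G' G)+
      also have "\<dots> = (LINT z|lborel. complex_of_real (gauss_kernel t (z - h) - gauss_kernel t z) * abs_D_powr s f (x - z))"
        by (simp add: G_def algebra_simps)
      finally have "norm (LINT \<xi>|lborel. complex_of_real (k t \<xi>) * (m \<xi> * p \<xi>))
        = norm (LINT z|lborel. complex_of_real (gauss_kernel t (z - h) - gauss_kernel t z) * abs_D_powr s f (x - z)) * t powr (s - 1)"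
        by (simp add: norm_mult)
      then have "ennreal (norm (LINT \<xi>|lborel. complex_of_real (k t \<xi>) * (m \<xi> * p \<xi>)))
        = ennreal (norm (LINT z|lborel. complex_of_real (gauss_kernel t (z - h) - gauss_kernel t z) * abs_D_powr s f (x - z))) * ennreal (t powr (s - 1))"
        by (simp add: ennreal_mult)
      also have "\<dots> \<le> (\<integral>\<^sup>+z. ennreal (norm (complex_of_real (gauss_kernel t (z - h) - gauss_kernel t z) * abs_D_powr s f (x - z))) \<partial>lborel) * ennreal (t powr (s - 1))"
        by (intro mult_right_mono norm_lebesgue_integral_le_nn_integral) simp
      finally show ?thesis using t
        by (simp add: norm_mult ennreal_mult flip: of_real_diff)
    qed (simp add: k_def)
  qed
  finally show ?thesis using c0 by simp
qed

subsection \<open>Smoothness of the Littlewood-Paley symbol\<close>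

text \<open>An algebra of functions, smooth off the origin and closed under differentiation there, that
  contains the symbol of the Littlewood-Paley projection.\<close>

inductive radial_expr :: "(real \<Rightarrow> real) \<Rightarrow> ('a::euclidean_space \<Rightarrow> real) \<Rightarrow> bool" for \<psi> where
  profile: "0 < a \<Longrightarrow> radial_expr \<psi> (\<lambda>x. (deriv ^^ m) \<psi> (a * norm x))"
| coordinate: "radial_expr \<psi> (\<lambda>x. x \<bullet> b)"
| inverse_norm: "radial_expr \<psi> (\<lambda>x. inverse (norm x))"
| const: "radial_expr \<psi> (\<lambda>x. c)"
| add: "radial_expr \<psi> u \<Longrightarrow> radial_expr \<psi> v \<Longrightarrow> radial_expr \<psi> (\<lambda>x. u x + v x)"
| mult: "radial_expr \<psi> u \<Longrightarrow> radial_expr \<psi> v \<Longrightarrow> radial_expr \<psi> (\<lambda>x. u x * v x)"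

lemma has_derivative_norm_euclidean:
  fixes x :: "'a::euclidean_space"
  assumes "x \<noteq> 0"
  shows "(norm has_derivative (\<lambda>b. (x \<bullet> b) * inverse (norm x))) (at x)"
  using has_derivative_norm[OF assms] by (rule has_derivative_eq_rhs) (simp add: fun_eq_iff sgn_div_norm inner_commute)

text \<open>The algebra must contain the derivative in each fixed direction b, because
  \<open>iter_deriv\<close> differentiates along one vector at a time.\<close>

lemma radial_expr_has_derivative:
  assumes \<psi>: "\<And>m t. 0 < t \<Longrightarrow> (deriv ^^ m) \<psi> differentiable (at t)" and "radial_expr \<psi> u"
  shows "\<exists>u'. (\<forall>x::'a::euclidean_space. x \<noteq> 0 \<longrightarrow> (u has_derivative u' x) (at x)) \<and> (\<forall>b. radial_expr \<psi> (\<lambda>x. u' x b))"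
  using assms(2)
proof (induction rule: radial_expr.induct)
  case (profile a m)
  define u' where "u' x b = (deriv ^^ Suc m) \<psi> (a * norm x) * (a * ((x \<bullet> b) * inverse (norm x)))" for x b :: 'a
  have "((\<lambda>x. (deriv ^^ m) \<psi> (a * norm x)) has_derivative u' x) (at x)" if "x \<noteq> 0" for x :: 'a
  proof -
    have "((deriv ^^ m) \<psi> has_field_derivative (deriv ^^ Suc m) \<psi> (a * norm x)) (at (a * norm x))"
      using \<psi>[of "a * norm x" m] profile that by (simp add: DERIV_deriv_iff_real_differentiable)
    then have "((deriv ^^ m) \<psi> has_derivative (\<lambda>h. (deriv ^^ Suc m) \<psi> (a * norm x) * h)) (at (a * norm x))"
      by (simp add: has_field_derivative_def)
    from has_derivative_compose[OF has_derivative_mult_right[OF has_derivative_norm_euclidean[OF that]] this]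
    show ?thesis by (simp add: u'_def[abs_def])
  qed
  moreover have "radial_expr \<psi> (\<lambda>x. u' x b)" for b
    unfolding u'_def by (intro radial_expr.intros profile)
  ultimately show ?case by blast
next
  case (coordinate b)
  have "((\<lambda>x. x \<bullet> b) has_derivative (\<lambda>h. h \<bullet> b)) (at x)" for x :: 'a
    by (intro derivative_eq_intros) auto
  then show ?case using radial_expr.const by (intro exI[of _ "\<lambda>_ h. h \<bullet> b"]) auto
next
  case inverse_norm
  define u' where "u' x b = - 1 * (inverse (norm x) * ((x \<bullet> b) * inverse (norm x)) * inverse (norm x))" for x b :: 'a
  have "((\<lambda>x. inverse (norm x)) has_derivative u' x) (at x)" if "x \<noteq> 0" for x :: 'a
    using Deriv.has_derivative_inverse[OF _ has_derivative_norm_euclidean[OF that]] that by (simp add: u'_def[abs_def])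
  moreover have "radial_expr \<psi> (\<lambda>x. u' x b)" for b
    unfolding u'_def by (intro radial_expr.intros)
  ultimately show ?case by blast
next
  case (const c)
  then show ?case by (intro exI[of _ "\<lambda>_ _. 0"]) (auto intro: radial_expr.const)
next
  case (add u v)
  then obtain u' v' where "\<And>x::'a. x \<noteq> 0 \<Longrightarrow> (u has_derivative u' x) (at x)" "\<And>b. radial_expr \<psi> (\<lambda>x. u' x b)"
    "\<And>x::'a. x \<noteq> 0 \<Longrightarrow> (v has_derivative v' x) (at x)" "\<And>b. radial_expr \<psi> (\<lambda>x. v' x b)" by blast
  then show ?case
    by (intro exI[of _ "\<lambda>x b. u' x b + v' x b"]) (auto intro!: has_derivative_add radial_expr.intros)
next
  case (mult u v)
  then obtain u' v' where "\<And>x::'a. x \<noteq> 0 \<Longrightarrow> (u has_derivative u' x) (at x)" "\<And>b. radial_expr \<psi> (\<lambda>x. u' x b)"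
    "\<And>x::'a. x \<noteq> 0 \<Longrightarrow> (v has_derivative v' x) (at x)" "\<And>b. radial_expr \<psi> (\<lambda>x. v' x b)" by blast
  then show ?case using mult.hyps
    by (intro exI[of _ "\<lambda>x b. u x * v' x b + u' x b * v x"]) (auto intro!: has_derivative_mult radial_expr.intros)
qed

lemma iter_deriv_radial_expr:
  fixes \<Phi> :: "'a::euclidean_space \<Rightarrow> complex"
  assumes \<psi>: "\<And>m t. 0 < t \<Longrightarrow> (deriv ^^ m) \<psi> differentiable (at t)"
    and u: "radial_expr \<psi> u" "\<And>x. x \<noteq> 0 \<Longrightarrow> \<Phi> x = complex_of_real (u x)"
  shows "(\<exists>v. radial_expr \<psi> v \<and> (\<forall>x. x \<noteq> 0 \<longrightarrow> iter_deriv bs \<Phi> x = complex_of_real (v x)))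
    \<and> (\<forall>x. x \<noteq> 0 \<longrightarrow> iter_deriv bs \<Phi> differentiable (at x))"
proof -
  \<comment> \<open>A derivative depends only on values nearby and the complement of the origin is
    open. Agreement with a radial expression there is therefore enough, whatever happens at
    0.\<close>
  have step: "\<exists>v'. (\<forall>x. x \<noteq> 0 \<longrightarrow> (\<Theta> has_derivative (\<lambda>b. complex_of_real (v' x b))) (at x)) \<and> (\<forall>b. radial_expr \<psi> (\<lambda>x. v' x b))"
    if v: "radial_expr \<psi> v" "\<And>x. x \<noteq> 0 \<Longrightarrow> \<Theta> x = complex_of_real (v x)" for v and \<Theta> :: "'a \<Rightarrow> complex"
  proof -
    from radial_expr_has_derivative[OF \<psi> v(1)] obtain v' where v':
      "\<And>x. x \<noteq> 0 \<Longrightarrow> (v has_derivative v' x) (at x)" "\<And>b. radial_expr \<psi> (\<lambda>x. v' x b)" by blast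
    have "(\<Theta> has_derivative (\<lambda>b. complex_of_real (v' x b))) (at x)" if "x \<noteq> 0" for x
    proof (rule has_derivative_transform_within_open)
      show "((\<lambda>x. complex_of_real (v x)) has_derivative (\<lambda>b. complex_of_real (v' x b))) (at x)"
        by (intro has_derivative_of_real v' that)
      show "open (- {0 :: 'a})" by (simp add: open_Compl)
    qed (use that v in auto)
    with v'(2) show ?thesis by blast
  qed
  have ex: "\<exists>v. radial_expr \<psi> v \<and> (\<forall>x. x \<noteq> 0 \<longrightarrow> iter_deriv bs \<Phi> x = complex_of_real (v x))"
  proof (induction bs)
    case (Cons b bs)
    then obtain v where v: "radial_expr \<psi> v" "\<And>x. x \<noteq> 0 \<Longrightarrow> iter_deriv bs \<Phi> x = complex_of_real (v x)" by blast
    from step[OF v] obtain v' where v': "\<And>x. x \<noteq> 0 \<Longrightarrow> (iter_deriv bs \<Phi> has_derivative (\<lambda>b. complex_of_real (v' x b))) (at x)"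
      "\<And>b. radial_expr \<psi> (\<lambda>x. v' x b)" by blast
    have "iter_deriv (b # bs) \<Phi> x = complex_of_real (v' x b)" if "x \<noteq> 0" for x
      unfolding iter_deriv_Cons using frechet_derivative_at[OF v'(1)[OF that]] by metis
    with v'(2) show ?case by blast
  qed (use u in auto)
  then obtain v where "radial_expr \<psi> v" "\<And>x. x \<noteq> 0 \<Longrightarrow> iter_deriv bs \<Phi> x = complex_of_real (v x)" by blast
  from step[OF this] ex show ?thesis unfolding differentiable_def by blast
qed

text \<open>Supplies the two regions where the symbol vanishes: a ball around the origin, where the
  radial expressions are singular, and the exterior of the support.\<close>

lemma iter_deriv_eq_0_on_open:
  assumes "open S" and 0: "\<And>x. x \<in> S \<Longrightarrow> f x = 0"
  shows "x \<in> S \<Longrightarrow> iter_deriv bs f x = 0 \<and> (iter_deriv bs f has_derivative (\<lambda>_. 0)) (at x)"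
proof (induction bs arbitrary: x)
  case Nil
  have "(f has_derivative (\<lambda>_. 0)) (at x)"
    by (rule has_derivative_transform_within_open[OF has_derivative_const \<open>open S\<close> Nil]) (use 0 in auto)
  with 0 Nil show ?case by auto
next
  case (Cons b bs)
  have eq: "iter_deriv (b # bs) f y = 0" if "y \<in> S" for y
    unfolding iter_deriv_Cons using frechet_derivative_at[of "iter_deriv bs f" "\<lambda>_. 0" y] Cons.IH[OF that] by metis
  have "(iter_deriv (b # bs) f has_derivative (\<lambda>_. 0)) (at x)"
    by (rule has_derivative_transform_within_open[OF has_derivative_const \<open>open S\<close> Cons.prems]) (use eq in auto)
  with eq Cons.prems show ?case by auto
qed

text \<open>The radial expressions give smoothness off the origin and vanishing near 0 gives it
  there. Outside the ball of radius 2 all derivatives vanish, so continuity on a compact ball bounds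
  every seminorm.\<close>

lemma schwartz_lp_symbol:
  assumes "lp_cutoff \<psi>"
  shows "schwartz (\<lambda>\<xi>::'a::euclidean_space. complex_of_real (lp_symbol \<psi> \<xi>))" (is "schwartz ?\<Phi>")
proof -
  have \<psi>: "\<And>m t. 0 < t \<Longrightarrow> (deriv ^^ m) \<psi> differentiable (at t)" "\<And>t. 2 < t \<Longrightarrow> \<psi> t = 0"
    "\<And>t. 0 \<le> t \<Longrightarrow> t \<le> 1 \<Longrightarrow> \<psi> t = 1"
    using assms by (auto simp: lp_cutoff_def)
  \<comment> \<open>The factors \<open>(deriv ^^ 0)\<close> and \<open>1 * norm x\<close> put the
    symbol into the shape of the rule \<open>profile\<close>.\<close>
  define u where "u x = (deriv ^^ 0) \<psi> (1 * norm x) + (- 1) * (deriv ^^ 0) \<psi> (2 * norm x)" for x :: 'a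
  have u: "radial_expr \<psi> u" unfolding u_def by (intro radial_expr.intros) auto
  have "?\<Phi> x = complex_of_real (u x)" for x by (simp add: u_def lp_symbol_def)
  note away = iter_deriv_radial_expr[OF \<psi>(1) u this]
  \<comment> \<open>For \<open>norm x < 1 / 2\<close> both arguments of \<psi> lie in [0, 1], so the
    two values 1 cancel.\<close>
  have near: "iter_deriv bs ?\<Phi> x = 0 \<and> (iter_deriv bs ?\<Phi> has_derivative (\<lambda>_. 0)) (at x)" if "norm x < 1 / 2" for bs x
    by (rule iter_deriv_eq_0_on_open[of "ball 0 (1 / 2)"]) (use that in \<open>auto simp: lp_symbol_def \<psi>(3)\<close>)
  have far: "iter_deriv bs ?\<Phi> x = 0" if "2 < norm x" for bs x
    using iter_deriv_eq_0_on_open[of "- cball 0 2" ?\<Phi> x bs] that by (auto simp: lp_symbol_def \<psi>(2))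
  have diff: "iter_deriv bs ?\<Phi> differentiable (at x)" for bs x
  proof (cases "x = 0")
    case True
    then show ?thesis using near[of x bs] unfolding differentiable_def by auto
  qed (use away in blast)
  have "bounded (range (\<lambda>x. norm x ^ N *\<^sub>R iter_deriv bs ?\<Phi> x))" for N bs
  proof -
    have "continuous_on UNIV (iter_deriv bs ?\<Phi>)"
      by (intro differentiable_imp_continuous_on) (auto simp: differentiable_on_def diff)
    then have "compact ((\<lambda>x. norm x ^ N *\<^sub>R iter_deriv bs ?\<Phi> x) ` cball 0 2)"
      by (intro compact_continuous_image continuous_intros) (auto intro: continuous_on_subset)
    then have "bounded (insert 0 ((\<lambda>x. norm x ^ N *\<^sub>R iter_deriv bs ?\<Phi> x) ` cball 0 2))"
      by (simp add: compact_imp_bounded)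
    moreover have "range (\<lambda>x. norm x ^ N *\<^sub>R iter_deriv bs ?\<Phi> x) \<subseteq> insert 0 ((\<lambda>x. norm x ^ N *\<^sub>R iter_deriv bs ?\<Phi> x) ` cball 0 2)"
    proof (rule image_subsetI)
      fix x
      show "norm x ^ N *\<^sub>R iter_deriv bs ?\<Phi> x \<in> insert 0 ((\<lambda>x. norm x ^ N *\<^sub>R iter_deriv bs ?\<Phi> x) ` cball 0 2)"
        using far[of x bs] by (cases "norm x \<le> 2") auto
    qed
    ultimately show ?thesis by (rule bounded_subset)
  qed
  with diff show ?thesis unfolding schwartz_def by blast
qed

subsection \<open>Inequalities for the \<open>L\<^sup>p\<close> norm\<close>

text \<open>Removes the case distinction and the root from the definition; the finite-exponent
  estimates below are proved for the integral of the power.\<close>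

lemma Lp_norm_le_iff_nn_integral:
  assumes P: "1 \<le> P" and B: "0 \<le> B"
  shows "Lp_norm (ennreal P) F \<le> ennreal B \<longleftrightarrow> (\<integral>\<^sup>+x. ennreal (norm (F x) powr P) \<partial>lborel) \<le> ennreal (B powr P)"
proof -
  define I where "I = (\<integral>\<^sup>+x. ennreal (norm (F x) powr P) \<partial>lborel)"
  have Lp: "Lp_norm (ennreal P) F = (if I = \<infinity> then \<infinity> else ennreal (enn2real I powr (1 / P)))"
    using P by (simp add: Lp_norm_def I_def Let_def)
  show ?thesis
  proof (cases I)
    case (real i)
    have "i powr (1 / P) \<le> B \<longleftrightarrow> i \<le> B powr P"
    proof
      assume "i powr (1 / P) \<le> B"
      then have "(i powr (1 / P)) powr P \<le> B powr P" using P by (intro powr_mono2) auto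
      then show "i \<le> B powr P" using P real by (simp add: powr_powr)
    next
      assume "i \<le> B powr P"
      then have "i powr (1 / P) \<le> (B powr P) powr (1 / P)" using P real by (intro powr_mono2) auto
      then show "i powr (1 / P) \<le> B" using P B by (simp add: powr_powr)
    qed
    then show ?thesis using real B unfolding I_def[symmetric] Lp by simp
  next
    case top
    then show ?thesis unfolding I_def[symmetric] Lp by (simp add: top_unique)
  qed
qed

lemma Lp_norm_infinity_le_iff:
  fixes F :: "'a::euclidean_space \<Rightarrow> complex"
  assumes [measurable]: "F \<in> borel_measurable borel" and B: "0 \<le> B"
  shows "Lp_norm \<infinity> F \<le> ennreal B \<longleftrightarrow> (AE x in lborel. norm (F x) \<le> B)"
proof
  assume le: "Lp_norm \<infinity> F \<le> ennreal B"
  have "AE x in lborel. ennreal (norm (F x)) \<le> Lp_norm \<infinity> F"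
    using esssup_AE[of "\<lambda>x. ennreal (norm (F x))" lborel] by (simp add: Lp_norm_def)
  then show "AE x in lborel. norm (F x) \<le> B"
  proof eventually_elim
    case (elim x)
    then have "ennreal (norm (F x)) \<le> ennreal B" using le by (rule order_trans)
    then show ?case using B by simp
  qed
next
  assume "AE x in lborel. norm (F x) \<le> B"
  then show "Lp_norm \<infinity> F \<le> ennreal B"
    unfolding Lp_norm_def by (auto intro!: esssup_I ennreal_leI elim!: eventually_mono)
qed

lemma ennreal_exponent_cases:
  assumes "1 \<le> (p :: ennreal)"
  obtains "p = \<infinity>" | P where "1 \<le> P" "p = ennreal P"
  using assms by (cases p) auto

lemma Lp_norm_eq_0_imp_AE:
  fixes F :: "'a::euclidean_space \<Rightarrow> complex"
  assumes [measurable]: "F \<in> borel_measurable borel" and p: "1 \<le> p" and 0: "Lp_norm p F = 0"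
  shows "AE x in lborel. F x = 0"
  using p
proof (cases rule: ennreal_exponent_cases)
  case 1
  then show ?thesis using Lp_norm_infinity_le_iff[of F 0] 0 by simp
next
  case (2 P)
  then have "(\<integral>\<^sup>+x. ennreal (norm (F x) powr P) \<partial>lborel) = 0"
    using Lp_norm_le_iff_nn_integral[of P 0 F] 0 by simp
  then show ?thesis by (subst (asm) nn_integral_0_iff_AE) (auto elim!: eventually_mono)
qed

lemma Lp_norm_0_if_AE:
  fixes F :: "'a::euclidean_space \<Rightarrow> complex"
  assumes [measurable]: "F \<in> borel_measurable borel" and p: "1 \<le> p" and 0: "AE x in lborel. F x = 0"
  shows "Lp_norm p F = 0"
  using p
proof (cases rule: ennreal_exponent_cases)
  case 1
  then show ?thesis using Lp_norm_infinity_le_iff[of F 0] 0 by simp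
next
  case (2 P)
  have "(\<integral>\<^sup>+x. ennreal (norm (F x) powr P) \<partial>lborel) = 0"
    by (subst nn_integral_0_iff_AE) (use 0 in \<open>auto elim!: eventually_mono\<close>)
  then show ?thesis using Lp_norm_le_iff_nn_integral[of P 0 F] 2 by simp
qed

text \<open>For the essential supremum one inequality comes from translation invariance of null
  sets; the other is the same inequality for the opposite translation.\<close>

lemma Lp_norm_translation:
  fixes F :: "'a::euclidean_space \<Rightarrow> complex"
  assumes [measurable]: "F \<in> borel_measurable borel"
  shows "Lp_norm p (\<lambda>x. F (x - a)) = Lp_norm p F"
proof -
  have esssup_le: "esssup lborel (\<lambda>x. f (x - a)) \<le> esssup lborel f"
    if [measurable]: "f \<in> borel_measurable borel" for f :: "'a \<Rightarrow> ennreal" and a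
  proof (rule esssup_I)
    have "AE x in distr lborel borel ((+) (- a)). f x \<le> esssup lborel f"
      unfolding lborel_distr_plus by (rule esssup_AE)
    then show "AE x in lborel. f (x - a) \<le> esssup lborel f"
      by (auto dest!: AE_distrD[rotated])
  qed measurable
  have "esssup lborel (\<lambda>x. ennreal (norm (F (x - a)))) = esssup lborel (\<lambda>x. ennreal (norm (F x)))"
    using esssup_le[of "\<lambda>x. ennreal (norm (F x))" a] esssup_le[of "\<lambda>x. ennreal (norm (F (x - a)))" "- a"]
    by (intro antisym) simp_all
  then show ?thesis
    using nn_integral_lborel_translation[of "\<lambda>x. ennreal (norm (F x) powr enn2real p)" a]
    by (simp add: Lp_norm_def)
qed

section \<open>Hoelder's inequality\<close>

lemma ennreal_pos_finite_cases:
  assumes "x \<noteq> 0" "x \<noteq> (\<infinity> :: ennreal)"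
  obtains r where "0 < r" "x = ennreal r"
proof (cases x)
  case (real r)
  with assms have "0 < r" by (cases "r = 0") auto
  with real that show ?thesis by blast
qed (use assms in simp)

text \<open>Needed when one exponent is infinite: its reciprocal is 0, and the exponent relation
  must identify the other two.\<close>

lemma ennreal_inverse_inject: "1 / p = 1 / q \<Longrightarrow> p = q" for p q :: ennreal
proof -
  assume "1 / p = 1 / q"
  then have eq: "inverse p = inverse q" by (simp add: divide_ennreal_def)
  consider "p = 0" | "p = \<infinity>" | r where "0 < r" "p = ennreal r"
    using ennreal_pos_finite_cases[of p] by blast
  then show "p = q"
  proof cases
    case 1
    then show ?thesis using eq by (metis ennreal_inverse_eq_top_iff ennreal_inverse_zero)
  next
    case 2
    then show ?thesis using eq by (metis ennreal_inverse_eq_0_iff ennreal_inverse_top infinity_ennreal_def)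
  next
    case (3 r)
    show ?thesis
    proof (cases q)
      case (real u)
      have "u \<noteq> 0"
      proof
        assume "u = 0"
        then show False using eq 3 real ennreal_inverse_eq_top_iff[of p] by simp
      qed
      then have "ennreal (inverse r) = ennreal (inverse u)" using eq 3 real by (simp add: inverse_ennreal)
      then show ?thesis using 3 real by simp
    next
      case top
      then show ?thesis using eq 3 ennreal_inverse_eq_0_iff[of p] by simp
    qed
  qed
qed

lemma one_divide_ennreal: "0 < x \<Longrightarrow> 1 / ennreal x = ennreal (1 / x)"
  using divide_ennreal[of 1 x] by simp

text \<open>The weights R / p and R / q sum to 1, so this is the weighted inequality of arithmetic
  and geometric means for \<open>a powr p\<close> and \<open>b powr q\<close>.\<close>

lemma young_powr:
  fixes a b R p q :: real
  assumes "0 \<le> a" "0 \<le> b" "0 < R" "0 < p" "0 < q" "1 / p + 1 / q = 1 / R"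
  shows "(a * b) powr R \<le> R / p * a powr p + R / q * b powr q"
proof (cases "a = 0 \<or> b = 0")
  case False
  have "R / p + R / q = 1"
    using arg_cong[OF assms(6), of "(*) R"] assms(3) by (simp add: distrib_left)
  then have "(a powr p) powr (R / p) * (b powr q) powr (R / q) \<le> R / p * a powr p + R / q * b powr q"
    using assms False by (intro Youngs_inequality_0) auto
  then show ?thesis using assms False by (simp add: powr_powr powr_mult)
qed (use assms in auto)

lemma Lp_norm_mult_infinity_le:
  fixes F g :: "'a::euclidean_space \<Rightarrow> complex"
  assumes [measurable]: "F \<in> borel_measurable borel" "g \<in> borel_measurable borel" and r: "1 \<le> r"
    and P: "0 \<le> P" "Lp_norm \<infinity> F \<le> ennreal P" and Q: "0 \<le> Q" "Lp_norm r g \<le> ennreal Q"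
  shows "Lp_norm r (\<lambda>x. F x * g x) \<le> ennreal (P * Q)"
proof -
  have F: "AE x in lborel. norm (F x) \<le> P" using P Lp_norm_infinity_le_iff[of F P] by simp
  show ?thesis using r
  proof (cases rule: ennreal_exponent_cases)
    case 1
    then have "AE x in lborel. norm (g x) \<le> Q" using Q Lp_norm_infinity_le_iff[of g Q] by simp
    with F have "AE x in lborel. norm (F x * g x) \<le> P * Q"
      by eventually_elim (simp add: norm_mult mult_mono' P Q)
    then show ?thesis using 1 P Q Lp_norm_infinity_le_iff[of "\<lambda>x. F x * g x" "P * Q"] by simp
  next
    case (2 R)
    have "(\<integral>\<^sup>+x. ennreal (norm (F x * g x) powr R) \<partial>lborel) \<le> (\<integral>\<^sup>+x. ennreal (P powr R) * ennreal (norm (g x) powr R) \<partial>lborel)"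
    proof (rule nn_integral_mono_AE, use F in eventually_elim)
      case (elim x)
      have "norm (F x * g x) powr R = norm (F x) powr R * norm (g x) powr R" by (simp add: norm_mult powr_mult)
      also have "\<dots> \<le> P powr R * norm (g x) powr R" using elim 2 by (intro mult_right_mono powr_mono2) auto
      finally show ?case by (simp add: ennreal_mult[symmetric] ennreal_leI)
    qed
    also have "\<dots> = ennreal (P powr R) * (\<integral>\<^sup>+x. ennreal (norm (g x) powr R) \<partial>lborel)"
      by (rule nn_integral_cmult) measurable
    also have "\<dots> \<le> ennreal (P powr R) * ennreal (Q powr R)"
      using Lp_norm_le_iff_nn_integral[of R Q g] 2 Q by (intro mult_left_mono) auto
    also have "\<dots> = ennreal ((P * Q) powr R)" using P Q by (simp add: ennreal_mult[symmetric] powr_mult)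
    finally show ?thesis using Lp_norm_le_iff_nn_integral[of R "P * Q" "\<lambda>x. F x * g x"] 2 P Q by simp
  qed
qed

lemma Lp_norm_mult_finite_le:
  fixes F g :: "'a::euclidean_space \<Rightarrow> complex"
  assumes [measurable]: "F \<in> borel_measurable borel" "g \<in> borel_measurable borel"
    and exps: "1 \<le> p" "1 \<le> q" "1 \<le> r" "1 / p + 1 / q = 1 / (r :: real)"
    and P: "0 < P" "Lp_norm (ennreal p) F \<le> ennreal P" and Q: "0 < Q" "Lp_norm (ennreal q) g \<le> ennreal Q"
  shows "Lp_norm (ennreal r) (\<lambda>x. F x * g x) \<le> ennreal (P * Q)"
proof -
  have F: "(\<integral>\<^sup>+x. ennreal (norm (F x) powr p) \<partial>lborel) \<le> ennreal (P powr p)"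
    using Lp_norm_le_iff_nn_integral[of p P F] P exps by simp
  have g: "(\<integral>\<^sup>+x. ennreal (norm (g x) powr q) \<partial>lborel) \<le> ennreal (Q powr q)"
    using Lp_norm_le_iff_nn_integral[of q Q g] Q exps by simp
  \<comment> \<open>The factors that arise when \<open>young_powr\<close> is applied to the
    normalised functions F / P and g / Q and the scaling is undone. Division by P and Q is why
    vanishing norms are treated separately.\<close>
  define \<alpha> where "\<alpha> = (P * Q) powr r * (r / p) / P powr p"
  define \<beta> where "\<beta> = (P * Q) powr r * (r / q) / Q powr q"
  have \<alpha>\<beta>: "0 \<le> \<alpha>" "0 \<le> \<beta>" using exps by (auto simp: \<alpha>_def \<beta>_def)
  have "(\<integral>\<^sup>+x. ennreal (norm (F x * g x) powr r) \<partial>lborel)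
    \<le> (\<integral>\<^sup>+x. ennreal \<alpha> * ennreal (norm (F x) powr p) + ennreal \<beta> * ennreal (norm (g x) powr q) \<partial>lborel)"
  proof (rule nn_integral_mono)
    fix x
    have "norm (F x * g x) powr r = (P * Q) powr r * ((norm (F x) / P) * (norm (g x) / Q)) powr r"
    proof -
      have "norm (F x * g x) = (P * Q) * ((norm (F x) / P) * (norm (g x) / Q))"
        using P Q by (simp add: norm_mult)
      then show ?thesis using powr_mult[of "P * Q" "(norm (F x) / P) * (norm (g x) / Q)" r] P Q by simp
    qed
    also have "\<dots> \<le> (P * Q) powr r * (r / p * (norm (F x) / P) powr p + r / q * (norm (g x) / Q) powr q)"
      using exps P Q by (intro mult_left_mono young_powr) auto
    also have "\<dots> = \<alpha> * norm (F x) powr p + \<beta> * norm (g x) powr q"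
      using P Q by (simp add: \<alpha>_def \<beta>_def powr_divide distrib_left)
    finally show "ennreal (norm (F x * g x) powr r)
      \<le> ennreal \<alpha> * ennreal (norm (F x) powr p) + ennreal \<beta> * ennreal (norm (g x) powr q)"
      using \<alpha>\<beta> by (simp add: ennreal_mult[symmetric] ennreal_plus[symmetric] ennreal_leI del: ennreal_plus)
  qed
  also have "\<dots> = ennreal \<alpha> * (\<integral>\<^sup>+x. ennreal (norm (F x) powr p) \<partial>lborel) + ennreal \<beta> * (\<integral>\<^sup>+x. ennreal (norm (g x) powr q) \<partial>lborel)"
    by (subst nn_integral_add) (simp_all add: nn_integral_cmult)
  also have "\<dots> \<le> ennreal \<alpha> * ennreal (P powr p) + ennreal \<beta> * ennreal (Q powr q)"
    using F g by (intro add_mono mult_left_mono) auto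
  also have "\<dots> = ennreal (\<alpha> * P powr p + \<beta> * Q powr q)"
    using \<alpha>\<beta> by (simp add: ennreal_mult[symmetric] ennreal_plus[symmetric] del: ennreal_plus)
  also have "\<alpha> * P powr p + \<beta> * Q powr q = (P * Q) powr r * (r * (1 / p + 1 / q))"
    using P Q by (simp add: \<alpha>_def \<beta>_def distrib_left)
  also have "\<dots> = (P * Q) powr r" using exps by simp
  finally show ?thesis using Lp_norm_le_iff_nn_integral[of r "P * Q" "\<lambda>x. F x * g x"] exps P Q by simp
qed

lemma Lp_norm_mult_le:
  fixes F g :: "'a::euclidean_space \<Rightarrow> complex"
  assumes meas [measurable]: "F \<in> borel_measurable borel" "g \<in> borel_measurable borel"
    and exps: "1 \<le> p" "1 \<le> q" "1 \<le> r" "1 / p + 1 / q = 1 / (r :: ennreal)"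
  shows "Lp_norm r (\<lambda>x. F x * g x) \<le> Lp_norm p F * Lp_norm q g"
proof (cases "Lp_norm p F = 0 \<or> Lp_norm q g = 0")
  case True
  \<comment> \<open>In \<open>ennreal\<close> the product of 0 and \<infinity> is 0. If one norm
    vanishes the left side must therefore vanish too, even when the other norm is infinite.\<close>
  then have "(AE x in lborel. F x = 0) \<or> (AE x in lborel. g x = 0)"
    using Lp_norm_eq_0_imp_AE[OF meas(1) exps(1)] Lp_norm_eq_0_imp_AE[OF meas(2) exps(2)] by auto
  then have "AE x in lborel. F x * g x = 0"
    by (elim disjE; elim eventually_mono) auto
  then have "Lp_norm r (\<lambda>x. F x * g x) = 0"
    using exps by (intro Lp_norm_0_if_AE) auto
  then show ?thesis by simp
next
  case nz: False
  show ?thesis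
  proof (cases "Lp_norm p F = \<infinity> \<or> Lp_norm q g = \<infinity>")
    case True
    then have "Lp_norm p F * Lp_norm q g = \<infinity>"
      using nz by (auto simp: ennreal_mult_eq_top_iff)
    then show ?thesis by simp
  next
    case False
    obtain P where P: "0 < P" "Lp_norm p F = ennreal P"
      using nz False by (auto elim: ennreal_pos_finite_cases[of "Lp_norm p F"])
    obtain Q where Q: "0 < Q" "Lp_norm q g = ennreal Q"
      using nz False by (auto elim: ennreal_pos_finite_cases[of "Lp_norm q g"])
    \<comment> \<open>An infinite p or q forces the other exponent to equal r. If both are finite
      then so is r, since 1 / r is positive.\<close>
    consider "p = \<infinity>" "q = r" | "q = \<infinity>" "p = r"
      | p' q' r' where "p = ennreal p'" "q = ennreal q'" "r = ennreal r'" "1 \<le> p'" "1 \<le> q'" "1 \<le> r'" "1 / p' + 1 / q' = 1 / r'"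
      using exps(1)
    proof (cases rule: ennreal_exponent_cases)
      case 1
      have "1 / q = 1 / r" unfolding exps(4)[symmetric] 1 by simp
      from that(1)[OF 1 ennreal_inverse_inject[OF this]] show ?thesis .
    next
      case p: (2 p')
      show ?thesis using exps(2)
      proof (cases rule: ennreal_exponent_cases)
        case 1
        have "1 / p = 1 / r" unfolding exps(4)[symmetric] 1 by simp
        from that(2)[OF 1 ennreal_inverse_inject[OF this]] show ?thesis .
      next
        case q: (2 q')
        have eq: "1 / r = ennreal (1 / p' + 1 / q')"
          unfolding exps(4)[symmetric] p(2) q(2) using p(1) q(1) by (simp add: one_divide_ennreal)
        have pos: "0 < 1 / p' + 1 / q'" using p q by (intro add_pos_pos) auto
        show ?thesis using exps(3)
        proof (cases rule: ennreal_exponent_cases)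
          case 1
          have "ennreal (1 / p' + 1 / q') = 0" unfolding eq[symmetric] 1 by simp
          with pos show ?thesis by (simp add: ennreal_eq_0_iff del: ennreal_plus)
        next
          case r: (2 r')
          have "ennreal (1 / r') = ennreal (1 / p' + 1 / q')"
            unfolding eq[symmetric] r(2) using r(1) by (subst one_divide_ennreal) auto
          then have "1 / p' + 1 / q' = 1 / r'" using r(1) pos by (subst (asm) ennreal_inj) auto
          from that(3)[OF p(2) q(2) r(2) p(1) q(1) r(1) this] show ?thesis .
        qed
      qed
    qed
    then have "Lp_norm r (\<lambda>x. F x * g x) \<le> ennreal (P * Q)"
    proof cases
      case 1
      then show ?thesis using P Q exps(3) by (intro Lp_norm_mult_infinity_le) simp_all
    next
      case 2
      then have "Lp_norm r (\<lambda>x. g x * F x) \<le> ennreal (Q * P)"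
        using P Q exps(3) by (intro Lp_norm_mult_infinity_le) simp_all
      then show ?thesis by (simp add: mult.commute)
    next
      case 3
      show ?thesis unfolding 3(3)
        using Lp_norm_mult_finite_le[OF meas 3(4-7) P(1) _ Q(1)] P(2) Q(2) 3(1,2) by simp
    qed
    then show ?thesis using P Q by (simp add: ennreal_mult)
  qed
qed

section \<open>Minkowski's integral inequality\<close>

lemma powr_tangent_le:
  fixes u a R :: real
  assumes "0 \<le> u" "0 < a" "1 \<le> R"
  shows "u \<le> a * (1 - 1 / R) + a powr (1 - R) / R * u powr R"
proof (cases "u = 0")
  case False
  \<comment> \<open>The claim says that the convex function \<open>u powr R\<close> lies above its
    tangent at a, solved for u. It is obtained here from Young's inequality with the weights 1 / R
    and 1 - 1 / R.\<close>
  have "(u powr R) powr (1 / R) * (a powr R) powr (1 - 1 / R) \<le> 1 / R * u powr R + (1 - 1 / R) * a powr R"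
    using assms False by (intro Youngs_inequality_0) auto
  moreover have "(u powr R) powr (1 / R) = u" using assms by (simp add: powr_powr)
  moreover have "R * (1 - 1 / R) = R - 1" using assms by (simp add: right_diff_distrib)
  ultimately have "u * a powr (R - 1) \<le> 1 / R * u powr R + (1 - 1 / R) * a powr R"
    by (simp add: powr_powr)
  from mult_right_mono[OF this, of "a powr (1 - R)"]
  have "u * (a powr (R - 1) * a powr (1 - R)) \<le> a powr (1 - R) / R * u powr R + (1 - 1 / R) * (a powr R * a powr (1 - R))"
    by (simp add: algebra_simps)
  then show ?thesis using assms by (simp add: powr_add[symmetric] mult.commute)
qed (use assms in auto)

text \<open>Jensen's inequality for a weight of mass at most \<open>A\<close>, without normalising
  it. Integrating the tangent inequality needs only this upper bound, because the constant term of
  the tangent line is nonnegative.\<close>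

lemma nn_integral_jensen_powr:
  assumes w [measurable]: "w \<in> borel_measurable M" and u [measurable]: "u \<in> borel_measurable M"
    and u0: "\<And>i. 0 \<le> u i" and R: "1 \<le> R" and A: "0 < A" "(\<integral>\<^sup>+i. w i \<partial>M) \<le> ennreal A"
    and v: "0 \<le> v" "ennreal v \<le> (\<integral>\<^sup>+i. w i * ennreal (u i) \<partial>M)"
  shows "ennreal (v powr R) \<le> ennreal (A powr (R - 1)) * (\<integral>\<^sup>+i. w i * ennreal (u i powr R) \<partial>M)"
proof (cases "v = 0")
  case False
  with v have v0: "0 < v" by simp
  define I where "I = (\<integral>\<^sup>+i. w i * ennreal (u i powr R) \<partial>M)"
  show ?thesis
  proof (cases I)
    case (real \<iota>)
    \<comment> \<open>The tangent point is the mean value. The constant term then contributes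
      \<open>v - v / R\<close>, so v cancels below and the power bound remains.\<close>
    define a where "a = v / A"
    have a: "0 < a" using v0 A by (simp add: a_def)
    define \<beta> where "\<beta> = a powr (1 - R) / R"
    have nn: "0 \<le> a * (1 - 1 / R)" "0 \<le> \<beta>" using a R by (auto simp: \<beta>_def)
    have "(\<integral>\<^sup>+i. w i * ennreal (u i) \<partial>M) \<le> (\<integral>\<^sup>+i. ennreal (a * (1 - 1 / R)) * w i + ennreal \<beta> * (w i * ennreal (u i powr R)) \<partial>M)"
    proof (rule nn_integral_mono)
      fix i
      have "ennreal (u i) \<le> ennreal (a * (1 - 1 / R) + \<beta> * u i powr R)"
        unfolding \<beta>_def by (intro ennreal_leI powr_tangent_le u0 a R)
      also have "\<dots> = ennreal (a * (1 - 1 / R)) + ennreal \<beta> * ennreal (u i powr R)"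
        using nn by (simp add: ennreal_mult)
      finally have "w i * ennreal (u i) \<le> w i * (ennreal (a * (1 - 1 / R)) + ennreal \<beta> * ennreal (u i powr R))"
        by (rule mult_left_mono) simp
      then show "w i * ennreal (u i) \<le> ennreal (a * (1 - 1 / R)) * w i + ennreal \<beta> * (w i * ennreal (u i powr R))"
        by (simp add: distrib_left mult_ac)
    qed
    also have "\<dots> = ennreal (a * (1 - 1 / R)) * (\<integral>\<^sup>+i. w i \<partial>M) + ennreal \<beta> * I"
      unfolding I_def by (subst nn_integral_add) (simp_all add: nn_integral_cmult)
    also have "\<dots> \<le> ennreal (a * (1 - 1 / R)) * ennreal A + ennreal \<beta> * ennreal \<iota>"
      unfolding real by (intro add_mono mult_left_mono A) auto
    also have "\<dots> = ennreal (a * (1 - 1 / R) * A + \<beta> * \<iota>)"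
      using nn A real by (simp add: ennreal_mult)
    finally have "ennreal v \<le> ennreal (a * (1 - 1 / R) * A + \<beta> * \<iota>)"
      by (rule order_trans[OF v(2)])
    moreover have "0 \<le> a * (1 - 1 / R) * A + \<beta> * \<iota>"
      using nn A(1) real(1) by (intro add_nonneg_nonneg mult_nonneg_nonneg[OF nn(1)] mult_nonneg_nonneg[OF nn(2)]) auto
    ultimately have "v \<le> a * (1 - 1 / R) * A + \<beta> * \<iota>"
      by (simp add: ennreal_le_iff)
    also have "\<dots> = v - v / R + a powr (1 - R) * \<iota> / R"
      using A by (simp add: a_def \<beta>_def algebra_simps)
    finally have "v \<le> a powr (1 - R) * \<iota>" using R by (simp add: field_simps)
    from mult_right_mono[OF this, of "v powr (R - 1)"]
    have "v powr R \<le> (a powr (1 - R) * v powr (R - 1)) * \<iota>"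
      using v0 powr_mult_base[of v "R - 1"] by (simp add: mult_ac)
    also have "a powr (1 - R) * v powr (R - 1) = A powr (R - 1)"
      using v0 A by (simp add: a_def powr_divide powr_diff field_simps)
    finally show ?thesis using real unfolding I_def[symmetric] by (simp add: ennreal_mult[symmetric] ennreal_leI)
  next
    case top
    then have "ennreal (A powr (R - 1)) * I = \<infinity>" using A by (simp add: ennreal_mult_eq_top_iff)
    then show ?thesis unfolding I_def by simp
  qed
qed simp

text \<open>For finite exponents Jensen's inequality is applied at each x and Tonelli's theorem
  moves the x-integral inside. The exponents recombine as
  \<open>A powr (R - 1) * A = A powr R\<close>.\<close>

lemma Lp_norm_average_le:
  fixes v :: "'a::euclidean_space \<Rightarrow> complex" and u :: "'i \<Rightarrow> 'a \<Rightarrow> complex"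
  assumes M: "sigma_finite_measure M"
    and v [measurable]: "v \<in> borel_measurable borel"
    and w [measurable]: "w \<in> borel_measurable M"
    and u [measurable]: "(\<lambda>(i, x). u i x) \<in> borel_measurable (M \<Otimes>\<^sub>M lborel)"
    and r: "1 \<le> r"
    and A: "0 < A" "(\<integral>\<^sup>+i. w i \<partial>M) \<le> ennreal A"
    and B: "\<And>i. Lp_norm r (u i) \<le> B"
    and le: "\<And>x. ennreal (norm (v x)) \<le> (\<integral>\<^sup>+i. w i * ennreal (norm (u i x)) \<partial>M)"
  shows "Lp_norm r v \<le> ennreal A * B"
proof (cases B)
  case (real b)
  interpret M: sigma_finite_measure M by (rule M)
  interpret pair: pair_sigma_finite M "lborel :: 'a measure" ..
  have [measurable]: "(\<lambda>z. u (fst z) (snd z)) \<in> borel_measurable (M \<Otimes>\<^sub>M lborel)"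
    using u by (simp add: split_beta')
  have [measurable]: "u i \<in> borel_measurable borel" if "i \<in> space M" for i
    using measurable_Pair2[OF u that] by simp
  show ?thesis using r
  proof (cases rule: ennreal_exponent_cases)
    case 1
    \<comment> \<open>For r = \<infinity> the bound holds for each i outside a null set of x
      depending on i. Joint measurability exchanges the two quantifiers.\<close>
    have "AE i in M. AE x in lborel. norm (u i x) \<le> b"
    proof (rule AE_I2)
      fix i assume "i \<in> space M"
      then show "AE x in lborel. norm (u i x) \<le> b"
        using B[of i] Lp_norm_infinity_le_iff[of "u i" b] real 1 by simp
    qed
    moreover have meas_le: "{z \<in> space (M \<Otimes>\<^sub>M lborel). norm (u (fst z) (snd z)) \<le> b} \<in> sets (M \<Otimes>\<^sub>M lborel)"
      by measurable
    ultimately have "AE x in lborel. AE i in M. norm (u i x) \<le> b"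
      using pair.AE_commute[of "\<lambda>i x. norm (u i x) \<le> b"] meas_le by simp
    then have "AE x in lborel. norm (v x) \<le> A * b"
    proof eventually_elim
      case (elim x)
      have "ennreal (norm (v x)) \<le> (\<integral>\<^sup>+i. ennreal b * w i \<partial>M)"
      proof (rule order_trans[OF le], rule nn_integral_mono_AE, use elim in eventually_elim)
        case (elim i)
        then show ?case by (subst mult.commute) (intro mult_right_mono ennreal_leI, auto)
      qed
      also have "\<dots> = ennreal b * (\<integral>\<^sup>+i. w i \<partial>M)" by (rule nn_integral_cmult) simp
      also have "\<dots> \<le> ennreal b * ennreal A" by (intro mult_left_mono A) simp
      finally show ?case using real A by (simp add: ennreal_mult[symmetric] mult.commute)
    qed
    then show ?thesis using 1 real A Lp_norm_infinity_le_iff[of v "A * b"] by (simp add: ennreal_mult)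
  next
    case (2 R)
    have "(\<integral>\<^sup>+x. ennreal (norm (v x) powr R) \<partial>lborel)
      \<le> (\<integral>\<^sup>+x. ennreal (A powr (R - 1)) * (\<integral>\<^sup>+i. w i * ennreal (norm (u i x) powr R) \<partial>M) \<partial>lborel)"
    proof (rule nn_integral_mono)
      fix x
      have [measurable]: "(\<lambda>i. u i x) \<in> borel_measurable M"
        using measurable_Pair1[OF u, of x] by simp
      show "ennreal (norm (v x) powr R) \<le> ennreal (A powr (R - 1)) * (\<integral>\<^sup>+i. w i * ennreal (norm (u i x) powr R) \<partial>M)"
        by (rule nn_integral_jensen_powr) (use 2 A le in auto)
    qed
    also have "\<dots> = ennreal (A powr (R - 1)) * (\<integral>\<^sup>+x. (\<integral>\<^sup>+i. w i * ennreal (norm (u i x) powr R) \<partial>M) \<partial>lborel)"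
      by (rule nn_integral_cmult) measurable
    also have "(\<integral>\<^sup>+x. (\<integral>\<^sup>+i. w i * ennreal (norm (u i x) powr R) \<partial>M) \<partial>lborel)
      = (\<integral>\<^sup>+i. (\<integral>\<^sup>+x. w i * ennreal (norm (u i x) powr R) \<partial>lborel) \<partial>M)"
      by (rule pair.Fubini') measurable
    also have "\<dots> \<le> (\<integral>\<^sup>+i. w i * ennreal (b powr R) \<partial>M)"
    proof (rule nn_integral_mono)
      fix i assume i [measurable]: "i \<in> space M"
      have "(\<integral>\<^sup>+x. w i * ennreal (norm (u i x) powr R) \<partial>lborel) = w i * (\<integral>\<^sup>+x. ennreal (norm (u i x) powr R) \<partial>lborel)"
        by (rule nn_integral_cmult) measurable
      also have "\<dots> \<le> w i * ennreal (b powr R)"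
        using B[of i] Lp_norm_le_iff_nn_integral[of R b "u i"] 2 real by (intro mult_left_mono) auto
      finally show "(\<integral>\<^sup>+x. w i * ennreal (norm (u i x) powr R) \<partial>lborel) \<le> w i * ennreal (b powr R)" .
    qed
    also have "\<dots> = (\<integral>\<^sup>+i. w i \<partial>M) * ennreal (b powr R)" by (rule nn_integral_multc) simp
    also have "\<dots> \<le> ennreal A * ennreal (b powr R)" by (intro mult_right_mono A) simp
    also have "ennreal (A powr (R - 1)) * (ennreal A * ennreal (b powr R)) = ennreal ((A * b) powr R)"
      using A real powr_mult_base[of A "R - 1"] by (simp add: ennreal_mult[symmetric] powr_mult mult_ac)
    finally have "(\<integral>\<^sup>+x. ennreal (norm (v x) powr R) \<partial>lborel) \<le> ennreal ((A * b) powr R)"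
      by (simp add: mult_left_mono)
    then show ?thesis using Lp_norm_le_iff_nn_integral[of R "A * b" v] 2 A real by (simp add: ennreal_mult)
  qed
next
  case top
  then show ?thesis using A by (simp add: ennreal_mult_top)
qed

subsection \<open>The commutator\<close>

lemma inverse_fourier_scale:
  fixes m :: "'a::euclidean_space \<Rightarrow> complex"
  assumes a: "0 < a"
  shows "inverse_fourier m (h /\<^sub>R a) = (a ^ DIM('a)) *\<^sub>R inverse_fourier (\<lambda>\<xi>. m (a *\<^sub>R \<xi>)) h"
  unfolding inverse_fourier_phase using a
  by (subst integral_lborel_affine[of a _ 0]) (simp_all add: mult.assoc[symmetric])

text \<open>The kernel is the reflected transform of \<Phi>, so this is
  \<open>abs_D_powr_integrand_integrable\<close> with frequency and space exchanged.\<close>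

lemma fourier_schwartz_weighted_integrable:
  fixes \<Phi> :: "'a::euclidean_space \<Rightarrow> complex"
  assumes "schwartz \<Phi>" "0 \<le> s" "s \<le> 1"
  shows "integrable lborel (\<lambda>h. norm (inverse_fourier \<Phi> h) * norm h powr s)"
proof -
  have "integrable lborel (\<lambda>\<xi>. norm (complex_of_real (norm \<xi> powr s) * fourier \<Phi> \<xi>))"
    by (intro integrable_norm abs_D_powr_integrand_integrable assms)
  from integrable_lborel_affine[OF this, of "-1" 0] show ?thesis
    by (simp add: norm_mult inverse_fourier_eq_fourier mult.commute)
qed

text \<open>Dilating the symbol by a replaces the kernel K(h) by \<open>a^(-n) K(h / a)\<close>. The
  weight |h|^s then contributes \<open>a powr s\<close>, the origin of the decay in k.\<close>

lemma nn_integral_inverse_fourier_scale: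
  fixes m :: "'a::euclidean_space \<Rightarrow> complex"
  assumes [measurable]: "m \<in> borel_measurable borel" and a: "0 < a"
  shows "(\<integral>\<^sup>+h. ennreal (norm (inverse_fourier (\<lambda>\<xi>. m (a *\<^sub>R \<xi>)) h) * norm h powr s) \<partial>lborel)
    = ennreal (a powr s) * (\<integral>\<^sup>+h. ennreal (norm (inverse_fourier m h) * norm h powr s) \<partial>lborel)"
proof -
  have [measurable]: "inverse_fourier m \<in> borel_measurable borel"
    "inverse_fourier (\<lambda>\<xi>. m (a *\<^sub>R \<xi>)) \<in> borel_measurable borel"
    by (intro borel_measurable_inverse_fourier; measurable)+
  define b where "b = inverse a"
  have b: "0 < b" using a by (simp add: b_def)
  have scale: "inverse_fourier m (b *\<^sub>R h) = (a ^ DIM('a)) *\<^sub>R inverse_fourier (\<lambda>\<xi>. m (a *\<^sub>R \<xi>)) h" for h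
    unfolding b_def by (rule inverse_fourier_scale[OF a])
  have "(\<integral>\<^sup>+h. ennreal (norm (inverse_fourier m h) * norm h powr s) \<partial>lborel)
    = ennreal (\<bar>b\<bar> ^ DIM('a)) * (\<integral>\<^sup>+h. ennreal (norm (inverse_fourier m (0 + b *\<^sub>R h)) * norm (0 + b *\<^sub>R h) powr s) \<partial>lborel)"
    by (rule nn_integral_lborel_affine) (measurable, use b in simp)
  also have "\<dots> = (\<integral>\<^sup>+h. ennreal (b ^ DIM('a)) * ennreal (norm (inverse_fourier m (b *\<^sub>R h)) * norm (b *\<^sub>R h) powr s) \<partial>lborel)"
    using b by (subst nn_integral_cmult) simp_all
  also have "\<dots> = (\<integral>\<^sup>+h. ennreal (b powr s) * ennreal (norm (inverse_fourier (\<lambda>\<xi>. m (a *\<^sub>R \<xi>)) h) * norm h powr s) \<partial>lborel)"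
  proof (intro nn_integral_cong)
    fix h :: 'a
    have "b ^ DIM('a) * a ^ DIM('a) = 1" using a by (simp add: b_def flip: power_mult_distrib)
    then have "b ^ DIM('a) * (norm (inverse_fourier m (b *\<^sub>R h)) * norm (b *\<^sub>R h) powr s)
      = b powr s * (norm (inverse_fourier (\<lambda>\<xi>. m (a *\<^sub>R \<xi>)) h) * norm h powr s)"
      unfolding scale using a b by (simp add: powr_mult mult_ac)
    then show "ennreal (b ^ DIM('a)) * ennreal (norm (inverse_fourier m (b *\<^sub>R h)) * norm (b *\<^sub>R h) powr s)
      = ennreal (b powr s) * ennreal (norm (inverse_fourier (\<lambda>\<xi>. m (a *\<^sub>R \<xi>)) h) * norm h powr s)"
      using b by (simp add: ennreal_mult[symmetric])
  qed
  also have "\<dots> = ennreal (b powr s) * (\<integral>\<^sup>+h. ennreal (norm (inverse_fourier (\<lambda>\<xi>. m (a *\<^sub>R \<xi>)) h) * norm h powr s) \<partial>lborel)"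
    by (rule nn_integral_cmult) measurable
  finally have "ennreal (a powr s) * (\<integral>\<^sup>+h. ennreal (norm (inverse_fourier m h) * norm h powr s) \<partial>lborel)
    = ennreal (a powr s) * ennreal (b powr s) * (\<integral>\<^sup>+h. ennreal (norm (inverse_fourier (\<lambda>\<xi>. m (a *\<^sub>R \<xi>)) h) * norm h powr s) \<partial>lborel)"
    by (simp add: mult.assoc)
  moreover have "ennreal (a powr s) * ennreal (b powr s) = 1"
    using a b by (simp add: ennreal_mult[symmetric] b_def flip: powr_mult)
  ultimately show ?thesis by simp
qed

text \<open>Here t is already integrated out. The product of translates depends on (h, z) only, so
  one application of Minkowski's inequality over pairs is enough.\<close>

definition kernel_weight :: "real \<Rightarrow> real \<Rightarrow> ('a::euclidean_space \<Rightarrow> complex) \<Rightarrow> 'a \<times> 'a \<Rightarrow> ennreal" where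
  "kernel_weight c s K = (\<lambda>(h, z). ennreal (norm (K h) / c) *
     (\<integral>\<^sup>+t. ennreal \<bar>gauss_kernel t (z - h) - gauss_kernel t z\<bar> * (ennreal (t powr (s - 1)) * indicator {0<..} t) \<partial>lborel))"

lemma kernel_weight_measurable:
  assumes [measurable]: "K \<in> borel_measurable borel"
  shows "kernel_weight c s K \<in> borel_measurable (lborel \<Otimes>\<^sub>M lborel)"
  unfolding kernel_weight_def by measurable

lemma nn_integral_kernel_weight_le:
  fixes K :: "'a::euclidean_space \<Rightarrow> complex"
  assumes [measurable]: "K \<in> borel_measurable borel" and s: "0 < s" "s < 1" and c: "0 < c"
  shows "(\<integral>\<^sup>+i. kernel_weight c s K i \<partial>(lborel \<Otimes>\<^sub>M lborel))
    \<le> ennreal (3 * (1 / s + 1 / (1 - s)) / c) * (\<integral>\<^sup>+h. ennreal (norm (K h) * norm h powr s) \<partial>lborel)"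
proof -
  let ?D = "\<lambda>t h z :: 'a. ennreal \<bar>gauss_kernel t (z - h) - gauss_kernel t z\<bar>"
  let ?m = "\<lambda>t. ennreal (t powr (s - 1)) * indicator {0<..} t :: ennreal"
  have "(\<integral>\<^sup>+i. kernel_weight c s K i \<partial>(lborel \<Otimes>\<^sub>M lborel))
    = (\<integral>\<^sup>+h. (\<integral>\<^sup>+z. kernel_weight c s K (h, z) \<partial>lborel) \<partial>lborel)"
    by (rule lborel.nn_integral_fst[symmetric]) (rule kernel_weight_measurable, simp)
  also have "\<dots> = (\<integral>\<^sup>+h. ennreal (norm (K h) / c) * (\<integral>\<^sup>+t. (\<integral>\<^sup>+z. ?D t h z \<partial>lborel) * ennreal (t powr (s - 1)) * indicator {0<..} t \<partial>lborel) \<partial>lborel)"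
  proof (intro nn_integral_cong)
    fix h :: 'a
    have "(\<integral>\<^sup>+z. kernel_weight c s K (h, z) \<partial>lborel) = ennreal (norm (K h) / c) * (\<integral>\<^sup>+z. (\<integral>\<^sup>+t. ?D t h z * ?m t \<partial>lborel) \<partial>lborel)"
      unfolding kernel_weight_def prod.case by (rule nn_integral_cmult) measurable
    \<comment> \<open>Integrating in z before t exposes the L^1 norm of the Gaussian
      increment.\<close>
    also have "(\<integral>\<^sup>+z. (\<integral>\<^sup>+t. ?D t h z * ?m t \<partial>lborel) \<partial>lborel) = (\<integral>\<^sup>+t. (\<integral>\<^sup>+z. ?D t h z * ?m t \<partial>lborel) \<partial>lborel)"
      by (rule lborel_pair.Fubini') measurable
    also have "\<dots> = (\<integral>\<^sup>+t. (\<integral>\<^sup>+z. ?D t h z \<partial>lborel) * ennreal (t powr (s - 1)) * indicator {0<..} t \<partial>lborel)"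
      by (subst nn_integral_multc) (simp_all add: mult.assoc)
    finally show "(\<integral>\<^sup>+z. kernel_weight c s K (h, z) \<partial>lborel) = ennreal (norm (K h) / c) *
       (\<integral>\<^sup>+t. (\<integral>\<^sup>+z. ?D t h z \<partial>lborel) * ennreal (t powr (s - 1)) * indicator {0<..} t \<partial>lborel)" .
  qed
  also have "\<dots> \<le> (\<integral>\<^sup>+h. ennreal (norm (K h) / c) * ennreal (3 * (1 / s + 1 / (1 - s)) * norm h powr s) \<partial>lborel)"
    by (intro nn_integral_mono mult_left_mono nn_integral_gauss_kernel_diff_powr_le s) simp
  also have "\<dots> = (\<integral>\<^sup>+h. ennreal (3 * (1 / s + 1 / (1 - s)) / c) * ennreal (norm (K h) * norm h powr s) \<partial>lborel)"
    using s c by (intro nn_integral_cong) (simp add: ennreal_mult[symmetric] mult_ac)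
  also have "\<dots> = ennreal (3 * (1 / s + 1 / (1 - s)) / c) * (\<integral>\<^sup>+h. ennreal (norm (K h) * norm h powr s) \<partial>lborel)"
    by (rule nn_integral_cmult) measurable
  finally show ?thesis .
qed

text \<open>Both multipliers are convolutions with the same kernel, so f(x) can be moved under the
  integral sign. The product f g is integrable because f is bounded and g integrable.\<close>

lemma commutator_eq_integral:
  fixes f g m :: "'a::euclidean_space \<Rightarrow> complex"
  assumes m: "integrable lborel m" and f: "schwartz f" and g: "schwartz g"
  shows "fourier_multiplier m (\<lambda>y. f y * g y) x - f x * fourier_multiplier m g x
    = (LINT h|lborel. inverse_fourier m h * ((f (x - h) - f x) * g (x - h)))"
proof -
  note [measurable] = schwartz_measurable[OF f] schwartz_measurable[OF g]
  obtain B where B: "\<And>x. norm (f x) \<le> B" using schwartz_bound[OF f, of 0] by auto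
  have g_int: "integrable lborel g" by (rule schwartz_integrable[OF g])
  have fg_int: "integrable lborel (\<lambda>y. f y * g y)"
  proof (rule Bochner_Integration.integrable_bound)
    show "integrable lborel (\<lambda>y. B * norm (g y))" using g_int by simp
    show "AE y in lborel. norm (f y * g y) \<le> norm (B * norm (g y))"
      using B by (intro AE_I2) (auto simp: norm_mult abs_mult intro!: mult_right_mono order_trans[OF B abs_ge_self])
  qed measurable
  note 1 = fourier_multiplier_eq_convolution[OF m g_int, of x]
  note 2 = fourier_multiplier_eq_convolution[OF m fg_int, of x]
  have "fourier_multiplier m (\<lambda>y. f y * g y) x - f x * fourier_multiplier m g x
    = (LINT h|lborel. inverse_fourier m h * (f (x - h) * g (x - h)) - f x * (inverse_fourier m h * g (x - h)))"
    unfolding 1(2) 2(2) by (subst Bochner_Integration.integral_diff) (use 1(1) 2(1) in auto)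
  also have "\<dots> = (LINT h|lborel. inverse_fourier m h * ((f (x - h) - f x) * g (x - h)))"
    by (simp add: algebra_simps)
  finally show ?thesis .
qed

text \<open>The bound for increments of f is inserted under the h-integral. Tonelli's theorem then
  makes t the innermost variable, where it becomes part of \<open>kernel_weight\<close>.\<close>

lemma norm_commutator_le:
  fixes f g m :: "'a::euclidean_space \<Rightarrow> complex"
  assumes m: "integrable lborel m" and f: "schwartz f" and g: "schwartz g" and s: "0 < s" "s < 1" and c0: "0 < c"
    and c: "\<And>a. 0 < a \<Longrightarrow>
      has_bochner_integral lborel (\<lambda>t. indicator {0<..} t * (exp (- pi * (t * a)\<^sup>2) * t powr (s - 1))) (c * a powr (- s))"
  shows "ennreal (norm (fourier_multiplier m (\<lambda>y. f y * g y) x - f x * fourier_multiplier m g x))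
    \<le> (\<integral>\<^sup>+i. kernel_weight c s (inverse_fourier m) i * ennreal (norm (abs_D_powr s f (x - snd i) * g (x - fst i))) \<partial>(lborel \<Otimes>\<^sub>M lborel))"
proof -
  define K where "K = inverse_fourier m"
  define F where "F = abs_D_powr s f"
  note [measurable] = schwartz_measurable[OF f] schwartz_measurable[OF g]
    fourier_borel_measurable[OF schwartz_measurable[OF f]]
  have [measurable]: "K \<in> borel_measurable borel"
    unfolding K_def using borel_measurable_integrable[OF m] by (intro borel_measurable_inverse_fourier) simp
  have [measurable]: "F \<in> borel_measurable borel"
    unfolding F_def abs_D_powr_def fourier_multiplier_def by (intro borel_measurable_inverse_fourier) measurable
  let ?D = "\<lambda>t h z :: 'a. ennreal \<bar>gauss_kernel t (z - h) - gauss_kernel t z\<bar>"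
  let ?m = "\<lambda>t. ennreal (t powr (s - 1)) * indicator {0<..} t :: ennreal"
  have "ennreal (norm (fourier_multiplier m (\<lambda>y. f y * g y) x - f x * fourier_multiplier m g x))
    \<le> (\<integral>\<^sup>+h. ennreal (norm (K h * ((f (x - h) - f x) * g (x - h)))) \<partial>lborel)"
    unfolding commutator_eq_integral[OF m f g] K_def by (rule norm_lebesgue_integral_le_nn_integral)
  also have "\<dots> \<le> (\<integral>\<^sup>+h. (\<integral>\<^sup>+z. kernel_weight c s K (h, z) * ennreal (norm (F (x - z) * g (x - h))) \<partial>lborel) \<partial>lborel)"
  proof (rule nn_integral_mono)
    fix h
    have "ennreal (norm (K h * ((f (x - h) - f x) * g (x - h))))
      = ennreal (norm (K h) / c) * ennreal (norm (g (x - h))) * ennreal (c * norm (f (x - h) - f x))"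
      using c0 by (simp add: ennreal_mult[symmetric] norm_mult mult_ac)
    also have "\<dots> \<le> ennreal (norm (K h) / c) * ennreal (norm (g (x - h))) *
        (\<integral>\<^sup>+t. (\<integral>\<^sup>+z. ?D t h z * ennreal (norm (F (x - z))) \<partial>lborel) * ennreal (t powr (s - 1)) * indicator {0<..} t \<partial>lborel)"
      unfolding F_def by (intro mult_left_mono schwartz_translation_diff_le f s c0 c) simp_all
    also have "(\<integral>\<^sup>+t. (\<integral>\<^sup>+z. ?D t h z * ennreal (norm (F (x - z))) \<partial>lborel) * ennreal (t powr (s - 1)) * indicator {0<..} t \<partial>lborel)
      = (\<integral>\<^sup>+t. (\<integral>\<^sup>+z. ?D t h z * ?m t * ennreal (norm (F (x - z))) \<partial>lborel) \<partial>lborel)"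
    proof (rule nn_integral_cong)
      fix t :: real
      have "(\<integral>\<^sup>+z. ?D t h z * ?m t * ennreal (norm (F (x - z))) \<partial>lborel)
        = (\<integral>\<^sup>+z. ?D t h z * ennreal (norm (F (x - z))) * ?m t \<partial>lborel)"
        by (simp add: mult_ac)
      also have "\<dots> = (\<integral>\<^sup>+z. ?D t h z * ennreal (norm (F (x - z))) \<partial>lborel) * ?m t"
        by (rule nn_integral_multc) measurable
      finally show "(\<integral>\<^sup>+z. ?D t h z * ennreal (norm (F (x - z))) \<partial>lborel) * ennreal (t powr (s - 1)) * indicator {0<..} t
        = (\<integral>\<^sup>+z. ?D t h z * ?m t * ennreal (norm (F (x - z))) \<partial>lborel)"
        by (simp add: mult.assoc)
    qed
    also have "\<dots> = (\<integral>\<^sup>+z. (\<integral>\<^sup>+t. ?D t h z * ?m t * ennreal (norm (F (x - z))) \<partial>lborel) \<partial>lborel)"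
      by (rule lborel_pair.Fubini') measurable
    also have "\<dots> = (\<integral>\<^sup>+z. (\<integral>\<^sup>+t. ?D t h z * ?m t \<partial>lborel) * ennreal (norm (F (x - z))) \<partial>lborel)"
      by (intro nn_integral_cong nn_integral_multc) measurable
    also have "ennreal (norm (K h) / c) * ennreal (norm (g (x - h))) * \<dots> =
      (\<integral>\<^sup>+z. ennreal (norm (K h) / c) * ennreal (norm (g (x - h))) * ((\<integral>\<^sup>+t. ?D t h z * ?m t \<partial>lborel) * ennreal (norm (F (x - z)))) \<partial>lborel)"
      by (rule nn_integral_cmult[symmetric]) measurable
    also have "\<dots> = (\<integral>\<^sup>+z. kernel_weight c s K (h, z) * ennreal (norm (F (x - z) * g (x - h))) \<partial>lborel)"
      unfolding kernel_weight_def prod.case norm_mult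
      by (intro nn_integral_cong) (subst ennreal_mult, simp_all add: mult_ac)
    finally show "ennreal (norm (K h * ((f (x - h) - f x) * g (x - h))))
      \<le> (\<integral>\<^sup>+z. kernel_weight c s K (h, z) * ennreal (norm (F (x - z) * g (x - h))) \<partial>lborel)" .
  qed
  also have "\<dots> = (\<integral>\<^sup>+h. (\<integral>\<^sup>+z. (\<lambda>i. kernel_weight c s K i * ennreal (norm (F (x - snd i) * g (x - fst i)))) (h, z) \<partial>lborel) \<partial>lborel)"
    by simp
  also have "\<dots> = (\<integral>\<^sup>+i. kernel_weight c s K i * ennreal (norm (F (x - snd i) * g (x - fst i))) \<partial>(lborel \<Otimes>\<^sub>M lborel))"
  proof (rule lborel.nn_integral_fst)
    have [measurable]: "kernel_weight c s K \<in> borel_measurable (lborel \<Otimes>\<^sub>M lborel)"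
      by (rule kernel_weight_measurable) simp
    show "(\<lambda>i. kernel_weight c s K i * ennreal (norm (F (x - snd i) * g (x - fst i)))) \<in> borel_measurable (lborel \<Otimes>\<^sub>M lborel)"
      by measurable
  qed
  finally show ?thesis unfolding K_def F_def .
qed

theorem corollary1p1:
  fixes \<psi> :: "real \<Rightarrow> real" and s :: real and p q r :: ennreal
  assumes "lp_cutoff \<psi>"
    and "0 < s" and "s < 1"
    and "1 \<le> p" and "1 \<le> q" and "1 \<le> r"
    and "1 / p + 1 / q = 1 / r"
  shows "\<exists>C::real. C > 0 \<and>
    (\<forall>k::int. \<forall>f g :: real ^ 'n \<Rightarrow> complex. schwartz f \<longrightarrow> schwartz g \<longrightarrow>
       Lp_norm r (lp_commutator \<psi> k f g)
         \<le> ennreal (C * 2 powr (- s * real_of_int k)) * Lp_norm p (abs_D_powr s f) * Lp_norm q g)"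
proof -
  define \<Phi> where "\<Phi> \<xi> = complex_of_real (lp_symbol \<psi> \<xi>)" for \<xi> :: "real ^ 'n"
  have \<Phi>: "schwartz \<Phi>" unfolding \<Phi>_def by (rule schwartz_lp_symbol[OF assms(1)])
  note [measurable] = schwartz_measurable[OF \<Phi>]
  obtain c where c: "0 < c" "\<And>a. 0 < a \<Longrightarrow>
      has_bochner_integral lborel (\<lambda>t. indicator {0<..} t * (exp (- pi * (t * a)\<^sup>2) * t powr (s - 1))) (c * a powr (- s))"
    using gaussian_subordination[OF assms(2,3)] by metis
  define B where "B = 3 * (1 / s + 1 / (1 - s)) / c"
  define D where "D = (LINT h|lborel. norm (inverse_fourier \<Phi> h) * norm h powr s)"
  have B: "0 \<le> B" using assms(2,3) c by (simp add: B_def)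
  have D: "0 \<le> D" unfolding D_def by (intro integral_nonneg_AE AE_I2) simp
  have D_eq: "(\<integral>\<^sup>+h. ennreal (norm (inverse_fourier \<Phi> h) * norm h powr s) \<partial>lborel) = ennreal D"
    unfolding D_def using assms(2,3)
    by (intro nn_integral_eq_integral fourier_schwartz_weighted_integrable \<Phi> AE_I2) auto
  \<comment> \<open>Fixed before k, f and g; the summand 1 makes it strictly positive.\<close>
  define C where "C = B * D + 1"
  have C: "0 < C" using B D by (simp add: C_def add_nonneg_pos)
  have "Lp_norm r (lp_commutator \<psi> k f g)
      \<le> ennreal (C * 2 powr (- s * real_of_int k)) * Lp_norm p (abs_D_powr s f) * Lp_norm q g"
    if f: "schwartz f" and g: "schwartz g" for k :: int and f g :: "real ^ 'n \<Rightarrow> complex"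
  proof -
    define a :: real where "a = 2 powi (- k)"
    have a: "0 < a" by (simp add: a_def)
    have a_powr: "a powr s = 2 powr (- s * real_of_int k)"
      unfolding a_def by (simp add: powr_real_of_int'[symmetric] powr_powr mult.commute)
    \<comment> \<open>The symbol of the k-th projection is \<Phi> dilated by
      \<open>a = 2^(-k)\<close>, and \<open>a powr s\<close> is the factor claimed.\<close>
    define m where "m \<xi> = \<Phi> (a *\<^sub>R \<xi>)" for \<xi>
    have m: "integrable lborel m"
      using integrable_lborel_affine[OF schwartz_integrable[OF \<Phi>], of a 0] a by (simp add: m_def[abs_def])
    have comm: "lp_commutator \<psi> k f g x = fourier_multiplier m (\<lambda>y. f y * g y) x - f x * fourier_multiplier m g x" for x
      by (simp add: lp_commutator_def lp_proj_def m_def[abs_def] \<Phi>_def a_def)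
    note [measurable] = schwartz_measurable[OF f] schwartz_measurable[OF g]
    have [measurable]: "m \<in> borel_measurable borel" using borel_measurable_integrable[OF m] by simp
    have meas_mult: "fourier_multiplier u v \<in> borel_measurable borel"
      if [measurable]: "u \<in> borel_measurable borel" "v \<in> borel_measurable borel" for u v :: "real ^ 'n \<Rightarrow> complex"
      unfolding fourier_multiplier_def using fourier_borel_measurable[OF that(2)]
      by (intro borel_measurable_inverse_fourier) measurable
    have [measurable]: "fourier_multiplier m (\<lambda>y. f y * g y) \<in> borel_measurable borel"
      "fourier_multiplier m g \<in> borel_measurable borel"
      by (rule meas_mult; measurable)+
    have [measurable]: "abs_D_powr s f \<in> borel_measurable borel"
      unfolding abs_D_powr_def by (rule meas_mult) measurable
    have [measurable]: "lp_commutator \<psi> k f g \<in> borel_measurable borel"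
      unfolding comm[abs_def] by measurable
    have K: "inverse_fourier m \<in> borel_measurable borel"
      by (rule borel_measurable_inverse_fourier) measurable
    \<comment> \<open>The total mass of the weight plays the role of \<open>A\<close> in
      \<open>Lp_norm_average_le\<close>.\<close>
    have "Lp_norm r (lp_commutator \<psi> k f g) \<le> ennreal (C * 2 powr (- s * real_of_int k)) * (Lp_norm p (abs_D_powr s f) * Lp_norm q g)"
    proof (rule Lp_norm_average_le[where M = "lborel \<Otimes>\<^sub>M lborel" and w = "kernel_weight c s (inverse_fourier m)"
          and u = "\<lambda>i x. abs_D_powr s f (x - snd i) * g (x - fst i)"])
      show "sigma_finite_measure (lborel \<Otimes>\<^sub>M lborel :: ((real ^ 'n) \<times> (real ^ 'n)) measure)"
        unfolding lborel_prod by (rule sigma_finite_lborel)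
      show "kernel_weight c s (inverse_fourier m) \<in> borel_measurable (lborel \<Otimes>\<^sub>M lborel)"
        by (rule kernel_weight_measurable[OF K])
      have "(\<integral>\<^sup>+i. kernel_weight c s (inverse_fourier m) i \<partial>(lborel \<Otimes>\<^sub>M lborel))
        \<le> ennreal B * (\<integral>\<^sup>+h. ennreal (norm (inverse_fourier m h) * norm h powr s) \<partial>lborel)"
        unfolding B_def by (rule nn_integral_kernel_weight_le[OF K assms(2,3) c(1)])
      also have "\<dots> = ennreal B * (ennreal (a powr s) * ennreal D)"
        unfolding m_def nn_integral_inverse_fourier_scale[OF schwartz_measurable[OF \<Phi>] a] D_eq ..
      also have "\<dots> = ennreal (B * D * a powr s)"
        using B D by (simp add: ennreal_mult[symmetric] mult_ac)
      also have "\<dots> \<le> ennreal (C * 2 powr (- s * real_of_int k))"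
        unfolding a_powr C_def by (intro ennreal_leI mult_right_mono) auto
      finally show "(\<integral>\<^sup>+i. kernel_weight c s (inverse_fourier m) i \<partial>(lborel \<Otimes>\<^sub>M lborel))
        \<le> ennreal (C * 2 powr (- s * real_of_int k))" .
      \<comment> \<open>Hoelder's inequality for each fixed pair (h, z); translation invariance
        makes the bound the same for all pairs.\<close>
      show "Lp_norm r (\<lambda>x. abs_D_powr s f (x - snd i) * g (x - fst i)) \<le> Lp_norm p (abs_D_powr s f) * Lp_norm q g" for i
        using Lp_norm_mult_le[of "\<lambda>x. abs_D_powr s f (x - snd i)" "\<lambda>x. g (x - fst i)" p q r] assms(4-7)
        by (simp add: Lp_norm_translation)
      show "ennreal (norm (lp_commutator \<psi> k f g x)) \<le> (\<integral>\<^sup>+i. kernel_weight c s (inverse_fourier m) i *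
        ennreal (norm (abs_D_powr s f (x - snd i) * g (x - fst i))) \<partial>(lborel \<Otimes>\<^sub>M lborel))" for x
        unfolding comm by (rule norm_commutator_le[OF m f g assms(2,3) c])
    qed (use C assms(6) in \<open>simp_all add: split_beta'\<close>)
    then show ?thesis by (simp add: mult.assoc)
  qed
  with C show ?thesis by blast
qed

end
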